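(* Fix $m>0$. Let $(\mu_n)_{n\in\mathbb N}$ be a sequence of probability measures on $\mathbb T=\mathbb R/2\pi\mathbb Z$ such that for every $n$ the cumulative distribution function $F_{\mu_n}$ satisfies $F_{\mu_n}(\theta+h)-F_{\mu_n}(\theta)\ge mh$ for all $\theta\in\mathbb R$, $h\ge0$. Assume that $(\mu_n)$ converges in law to a probability measure $\mu$ on $\mathbb T$ and that $\mu$ is absolutely continuous with respect to Lebesgue measure. Let $F_n$ (resp. $F_\infty$), defined on $[0,\infty)\times\mathbb R$, be a viscosity solution of $$\partial_t F(t,\theta)+\frac1\pi\left(\arctan\left(\frac{A_0[F(t,\cdot)](\theta)}{(\partial_\theta F(t,\theta))_+}\right)+\frac{\pi}{2}\right)=0\quad\text{in }(0,+\infty)\times\mathbb R$$ with initial condition $F_{\mu_n}$ (resp. $F_\mu$), and assume that each of the functions $G\in\{F_n: n\in\mathbb N\}\cup\{F_\infty\}$ satisfies, for some $m'\in(0,m]$ (possibly depending on $G$), $G(t,\theta+h)-G(t,\theta)\ge m'h$ for all $t\ge0$, $\theta\in\mathbb R$, $h\ge0$. Then $$\sup_{t\ge 0}\|F_n(t,\cdot)-F_\infty(t,\cdot)\|_{L^\infty(\mathbb R)}\underset{n\to+\infty}{\longrightarrow}0.$$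
   Context: **Cumulative distribution function.** A probability measure $\mu$ on $\mathbb T$ is identified with its $2\pi$-periodic lift to $\mathbb R$. Set $F_\mu(x)=\mu([0,x])$ if $x\ge 0$ and $F_\mu(x)=-\mu((x,0))$ if $x<0$. Thus $F_\mu$ is non-decreasing, right-continuous and $F_\mu(x+2\pi)=F_\mu(x)+1$. **Envelopes.** For a locally bounded function $F$ on a subset $\Omega$ of $\mathbb R^d$ and $x\in\Omega$: $F_*(x)=\liminf_{y\to x}F(y)$ and $F^*(x)=\limsup_{y\to x}F(y)$ (lower and upper semicontinuous envelopes; $y\in\Omega$, $y=x$ allowed). **Function spaces.** $\mathcal F_{t,2\pi}$ is the set of functions $F:[0,\infty)\times\mathbb R\to\mathbb R$ for which there is $a\in\mathbb R$ with $F(t,x+2\pi)=F(t,x)+a$ for all $t\ge0$, $x\in\mathbb R$. $C^{1,1}_{t,2\pi}$ is the set of $C^1$ functions $\phi:[0,\infty)\times\mathbb R\to\mathbb R$ such that $\partial_x\phi$ is Lipschitz and $\phi\in\mathcal F_{t,2\pi}$. **Half-Laplacian.** For a $C^1$ function $f:\mathbb R\to\mathbb R$ with $f'$ Lipschitz and $f(x+2\pi)-f(x)$ constant, $$A_0[f](\theta)=\frac1{8\pi}\int_{-\pi}^{\pi}\frac{2f(\theta)-f(\theta-\theta')-f(\theta+\theta')}{\sin^2(\theta'/2)}\,d\theta'.$$ **Viscosity solutions.** Write $y_+=\max(y,0)$. - An upper semicontinuous $F\in\mathcal F_{t,2\pi}$ is a viscosity subsolution if for every $\phi\in C^{1,1}_{t,2\pi}$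 and every point $(t_0,\theta_0)\in(0,\infty)\times\mathbb R$ of strict maximum of $F-\phi$ with $\partial_\theta\phi(t_0,\theta_0)\ne0$, $$\partial_t\phi(t_0,\theta_0)+\frac1\pi\left(\arctan\left(\frac{A_0[\phi(t_0,\cdot)](\theta_0)}{(\partial_\theta\phi(t_0,\theta_0))_+}\right)+\frac\pi2\right)\le0.$$ - A lower semicontinuous $F\in\mathcal F_{t,2\pi}$ is a viscosity supersolution if the same holds with "strict maximum" replaced by "strict minimum" and $\le0$ replaced by $\ge0$. - A viscosity solution is a locally bounded function $F$ such that $F$ is a subsolution and $F_*$ is a supersolution. - $F$ has initial condition $F_0$ if $F^*(0,\cdot)\le (F_0)^*$ and $F_*(0,\cdot)\ge(F_0)_*$. Here a strict maximum (minimum) is a maximum (minimum) over $[0,\infty)\times\mathbb R$, attained only at the points $(t_0,\theta_0+2\pi k)$, $k\in\mathbb Z$. For functions $F$ with $F(t,\theta+h)-F(t,\theta)\ge m'h$ for all $t,h\ge 0$, $\theta\in\mathbb R$, one always has $\partial_\theta\phi(t_0,\theta_0)\ge m'>0$ at such points, so no division by zero occurs. *)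

theory Defs
  imports "HOL-Probability.Probability"
begin

section \<open>Probability measures on the circle\<close>

text \<open>
  A probability measure on the circle (the real line modulo the integer multiples of \<open>2\<pi>\<close>) is
  identified with its \<open>2\<pi>\<close>-periodic lift, a Borel measure on the real line: the mass of one period
  is \<open>1\<close>, and the total mass of the lift is infinite.
\<close>

definition one_period :: "real measure \<Rightarrow> real measure" where
  "one_period \<mu> = restrict_space \<mu> {0..<2 * pi}"

definition circle_prob :: "real measure \<Rightarrow> bool" where
  "circle_prob \<mu> \<longleftrightarrow> sets \<mu> = sets borel \<and> distr \<mu> borel (\<lambda>x. x + 2 * pi) = \<mu> \<and>
     prob_space (one_period \<mu>)"

definition circle_cdf :: "real measure \<Rightarrow> real \<Rightarrow> real" where
  "circle_cdf \<mu> x = (if x \<ge> 0 then measure \<mu> {0..x} else - measure \<mu> {x<..<0})"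

text \<open>Continuous functions on the circle are the continuous \<open>2\<pi>\<close>-periodic functions on the line;
  they are bounded.\<close>

definition circle_conv_in_law :: "(nat \<Rightarrow> real measure) \<Rightarrow> real measure \<Rightarrow> bool" where
  "circle_conv_in_law \<mu> \<nu> \<longleftrightarrow>
     (\<forall>f :: real \<Rightarrow> real. continuous_on UNIV f \<and> (\<forall>x. f (x + 2 * pi) = f x) \<longrightarrow>
        (\<lambda>n. \<integral>x. f x \<partial>one_period (\<mu> n)) \<longlonglongrightarrow> (\<integral>x. f x \<partial>one_period \<nu>))"


section \<open>Semicontinuity and envelopes\<close>

text \<open>The filter of the limits \<open>y \<rightarrow> x\<close> with \<open>y \<in> \<Omega>\<close>, where \<open>y = x\<close> is allowed
  (in contrast to \<open>at x within \<Omega>\<close>).\<close>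

definition nhds_within :: "'a::topological_space \<Rightarrow> 'a set \<Rightarrow> 'a filter" where
  "nhds_within x \<Omega> = inf (nhds x) (principal \<Omega>)"

definition locally_bounded_on :: "'a::topological_space set \<Rightarrow> ('a \<Rightarrow> real) \<Rightarrow> bool" where
  "locally_bounded_on \<Omega> F \<longleftrightarrow> (\<forall>x\<in>\<Omega>. \<exists>C. \<forall>\<^sub>F y in nhds_within x \<Omega>. \<bar>F y\<bar> \<le> C)"

text \<open>The limits inferior and superior are taken in the extended reals. They are finite when
  \<open>F\<close> is locally bounded on \<open>\<Omega>\<close> and \<open>x \<in> \<Omega>\<close>, the only case in which the envelopes are used.\<close>

definition lower_envelope :: "'a::topological_space set \<Rightarrow> ('a \<Rightarrow> real) \<Rightarrow> 'a \<Rightarrow> real" where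
  "lower_envelope \<Omega> F x = real_of_ereal (Liminf (nhds_within x \<Omega>) (\<lambda>y. ereal (F y)))"

definition upper_envelope :: "'a::topological_space set \<Rightarrow> ('a \<Rightarrow> real) \<Rightarrow> 'a \<Rightarrow> real" where
  "upper_envelope \<Omega> F x = real_of_ereal (Limsup (nhds_within x \<Omega>) (\<lambda>y. ereal (F y)))"

definition usc_on :: "'a::topological_space set \<Rightarrow> ('a \<Rightarrow> real) \<Rightarrow> bool" where
  "usc_on \<Omega> F \<longleftrightarrow> (\<forall>x\<in>\<Omega>. Limsup (nhds_within x \<Omega>) (\<lambda>y. ereal (F y)) \<le> ereal (F x))"

definition lsc_on :: "'a::topological_space set \<Rightarrow> ('a \<Rightarrow> real) \<Rightarrow> bool" where
  "lsc_on \<Omega> F \<longleftrightarrow> (\<forall>x\<in>\<Omega>. ereal (F x) \<le> Liminf (nhds_within x \<Omega>) (\<lambda>y. ereal (F y)))"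


section \<open>Function spaces\<close>

text \<open>Functions of time and space are total functions of the pair \<open>(t, x)\<close>; all notions below
  depend only on their values on the following set.\<close>

definition half_space :: "(real \<times> real) set" where
  "half_space = {0..} \<times> UNIV"

definition F_space :: "(real \<times> real \<Rightarrow> real) set" where
  "F_space = {F. \<exists>a. \<forall>t\<ge>0. \<forall>x. F (t, x + 2 * pi) = F (t, x) + a}"

definition partial_t :: "(real \<times> real \<Rightarrow> real) \<Rightarrow> real \<times> real \<Rightarrow> real" where
  "partial_t \<phi> = (\<lambda>(t, x). deriv (\<lambda>s. \<phi> (s, x)) t)"

definition partial_x :: "(real \<times> real \<Rightarrow> real) \<Rightarrow> real \<times> real \<Rightarrow> real" where
  "partial_x \<phi> = (\<lambda>(t, x). deriv (\<lambda>y. \<phi> (t, y)) x)"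

text \<open>Differentiability at \<open>t = 0\<close> is one-sided in time: derivatives are taken within \<open>\<Omega>\<close>.\<close>

definition C1_on :: "(real \<times> real) set \<Rightarrow> (real \<times> real \<Rightarrow> real) \<Rightarrow> bool" where
  "C1_on \<Omega> \<phi> \<longleftrightarrow> (\<exists>\<phi>' :: real \<times> real \<Rightarrow> (real \<times> real) \<Rightarrow>\<^sub>L real.
     (\<forall>p\<in>\<Omega>. (\<phi> has_derivative blinfun_apply (\<phi>' p)) (at p within \<Omega>)) \<and> continuous_on \<Omega> \<phi>')"

definition C11_space :: "(real \<times> real \<Rightarrow> real) set" where
  "C11_space = {\<phi>. C1_on half_space \<phi> \<and> (\<exists>L. L-lipschitz_on half_space (partial_x \<phi>)) \<and>
     \<phi> \<in> F_space}"


section \<open>The half-Laplacian and viscosity solutions\<close>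

definition A0 :: "(real \<Rightarrow> real) \<Rightarrow> real \<Rightarrow> real" where
  "A0 f \<theta> = 1 / (8 * pi) *
     (LINT \<theta>':{-pi..pi}|lborel. (2 * f \<theta> - f (\<theta> - \<theta>') - f (\<theta> + \<theta>')) / (sin (\<theta>' / 2))\<^sup>2)"

definition pde_lhs :: "(real \<times> real \<Rightarrow> real) \<Rightarrow> real \<times> real \<Rightarrow> real" where
  "pde_lhs \<phi> = (\<lambda>(t, \<theta>). partial_t \<phi> (t, \<theta>) +
     1 / pi * (arctan (A0 (\<lambda>x. \<phi> (t, x)) \<theta> / max (partial_x \<phi> (t, \<theta>)) 0) + pi / 2))"

definition strict_max_at :: "(real \<times> real \<Rightarrow> real) \<Rightarrow> real \<times> real \<Rightarrow> bool" where
  "strict_max_at G = (\<lambda>(t0, \<theta>0).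
     (\<forall>p\<in>half_space. G p \<le> G (t0, \<theta>0)) \<and>
     (\<forall>p\<in>half_space. G p = G (t0, \<theta>0) \<longrightarrow> (\<exists>k::int. p = (t0, \<theta>0 + 2 * pi * of_int k))))"

definition strict_min_at :: "(real \<times> real \<Rightarrow> real) \<Rightarrow> real \<times> real \<Rightarrow> bool" where
  "strict_min_at G = (\<lambda>(t0, \<theta>0).
     (\<forall>p\<in>half_space. G (t0, \<theta>0) \<le> G p) \<and>
     (\<forall>p\<in>half_space. G p = G (t0, \<theta>0) \<longrightarrow> (\<exists>k::int. p = (t0, \<theta>0 + 2 * pi * of_int k))))"

definition viscosity_subsolution :: "(real \<times> real \<Rightarrow> real) \<Rightarrow> bool" where
  "viscosity_subsolution F \<longleftrightarrow> F \<in> F_space \<and> usc_on half_space F \<and>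
     (\<forall>\<phi>\<in>C11_space. \<forall>t0>0. \<forall>\<theta>0. strict_max_at (\<lambda>p. F p - \<phi> p) (t0, \<theta>0) \<longrightarrow>
        partial_x \<phi> (t0, \<theta>0) \<noteq> 0 \<longrightarrow> pde_lhs \<phi> (t0, \<theta>0) \<le> 0)"

definition viscosity_supersolution :: "(real \<times> real \<Rightarrow> real) \<Rightarrow> bool" where
  "viscosity_supersolution F \<longleftrightarrow> F \<in> F_space \<and> lsc_on half_space F \<and>
     (\<forall>\<phi>\<in>C11_space. \<forall>t0>0. \<forall>\<theta>0. strict_min_at (\<lambda>p. F p - \<phi> p) (t0, \<theta>0) \<longrightarrow>
        partial_x \<phi> (t0, \<theta>0) \<noteq> 0 \<longrightarrow> pde_lhs \<phi> (t0, \<theta>0) \<ge> 0)"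

definition viscosity_solution :: "(real \<times> real \<Rightarrow> real) \<Rightarrow> bool" where
  "viscosity_solution F \<longleftrightarrow> locally_bounded_on half_space F \<and> viscosity_subsolution F \<and>
     viscosity_supersolution (lower_envelope half_space F)"

definition has_initial_condition :: "(real \<times> real \<Rightarrow> real) \<Rightarrow> (real \<Rightarrow> real) \<Rightarrow> bool" where
  "has_initial_condition F F0 \<longleftrightarrow>
     (\<forall>x. upper_envelope half_space F (0, x) \<le> upper_envelope UNIV F0 x \<and>
          lower_envelope half_space F (0, x) \<ge> lower_envelope UNIV F0 x)"

definition space_growth :: "real \<Rightarrow> (real \<times> real \<Rightarrow> real) \<Rightarrow> bool" where
  "space_growth m G \<longleftrightarrow> (\<forall>t\<ge>0. \<forall>\<theta>. \<forall>h\<ge>0. G (t, \<theta> + h) - G (t, \<theta>) \<ge> m * h)"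

text \<open>The norm of \<open>L\<^sup>\<infinity>\<close> for Lebesgue measure on the line, with values in the extended reals.\<close>

definition Linf_norm :: "(real \<Rightarrow> real) \<Rightarrow> ereal" where
  "Linf_norm f = esssup lborel (\<lambda>x. ereal \<bar>f x\<bar>)"

end

theory Submission
  imports Defs
begin

text \<open>
  The cumulative distribution functions converge uniformly because the limit is continuous, so
  everything follows from a comparison principle: a subsolution \<open>U\<close> and a supersolution \<open>V\<close>
  with \<open>U \<le> V + e\<close> at time \<open>0\<close> satisfy \<open>U \<le> V + e\<close> at all times.

  For the comparison principle one doubles variables and maximises
  \<open>U p - V q - \<alpha> / 2 * (norm (p - q))\<^sup>2\<close> (after a penalisation in time). No estimate of the nonlocal
  term is needed: the sup-convolution of \<open>U\<close> is semiconvex, lies below the semiconcave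
  inf-convolution of \<open>V\<close> (up to the constant given by the maximum), and between the two there is a
  function \<open>\<phi>\<close> of class \<open>C\<^sup>1\<^sup>,\<^sup>1\<close>, as in Ilmanen's lemma. Two translates of this single \<open>\<phi>\<close> touch \<open>U\<close>
  from above and \<open>V\<close> from below, at points corresponding to the same point \<open>z\<close>. Both viscosity
  inequalities then involve the same derivatives and the same half-Laplacian of \<open>\<phi>\<close> at \<open>z\<close>, and they
  contradict the strictly monotone penalisation in time.
\<close>

section \<open>Differentiable interpolation between semiconvex and semiconcave functions\<close>

text \<open>Three features of the equation shape the argument. Test functions must touch strictly,
  while \<open>\<phi>\<close> only touches. The correction
  \<open>\<kappa> * ((t - t0)\<^sup>2 + (1 - cos (x - x0)))\<close> makes contact strict, respects
  quasi-periodicity and has zero gradient at the contact point, so it is felt only by the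
  half-Laplacian, by at most \<open>\<kappa>\<close>. This error is divided by the slope
  \<open>P\<close> of \<open>\<phi>\<close>, which the growth of the subsolution keeps at least
  \<open>m > 0\<close>. With \<open>\<kappa> = \<eta> * P\<close> the two arctan terms differ by at
  most \<open>2 * \<eta>\<close>, hence the operators by \<open>2 * \<eta> / pi\<close>, less than
  the \<open>2 * \<eta>\<close> gained from the time penalty. Time is unbounded and no growth rate
  in time is known, so the penalty contains a \<open>C\<^sup>1\<close> function built to dominate
  the solutions. The parameter \<open>\<alpha>\<close> stays fixed: it need only be large enough to
  keep the maximum away from time 0, and no limit in \<open>\<alpha>\<close> is taken. The resulting
  bound contains neither the time nor the growth constants. It is therefore uniform in time, and
  those constants may vary with \<open>n\<close>.\<close>

lemma convex_on_subgradient: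
  fixes k :: "'a::euclidean_space \<Rightarrow> real"
  assumes "convex_on UNIV k"
  shows "\<exists>\<xi>. \<forall>v. k (x + v) \<ge> k x + \<xi> \<bullet> v"
proof -
  \<comment> \<open>The strict epigraph of \<open>k\<close>, recentred so that
    \<open>(x, k x)\<close> becomes the origin. It misses \<open>0\<close>, and a separating
    hyperplane has the subgradient as its slope.\<close>
  define S where "S = {p :: 'a \<times> real. k (x + fst p) < k x + snd p}"
  have "convex S"
  proof (rule convexI)
    fix p q :: "'a \<times> real" and u v :: real
    assume p: "p \<in> S" "q \<in> S" and u: "0 \<le> u" "0 \<le> v" "u + v = 1"
    have "x = u *\<^sub>R x + v *\<^sub>R x" using u(3) by (metis scaleR_add_left scaleR_one)
    then have "x + fst (u *\<^sub>R p + v *\<^sub>R q) = u *\<^sub>R (x + fst p) + v *\<^sub>R (x + fst q)"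
      by (simp add: scaleR_add_right)
    moreover have "k (u *\<^sub>R (x + fst p) + v *\<^sub>R (x + fst q)) \<le> u * k (x + fst p) + v * k (x + fst q)"
      using assms u by (simp add: convex_on_def)
    ultimately have "k (x + fst (u *\<^sub>R p + v *\<^sub>R q)) \<le> u * k (x + fst p) + v * k (x + fst q)"
      by simp
    also have "\<dots> < u * (k x + snd p) + v * (k x + snd q)"
    proof (cases "u = 0")
      case True
      then show ?thesis using p u by (auto simp: S_def)
    next
      case False
      then show ?thesis using p u unfolding S_def
        by (intro add_less_le_mono mult_strict_left_mono mult_left_mono) auto
    qed
    also have "\<dots> = k x + snd (u *\<^sub>R p + v *\<^sub>R q)"
    proof -
      have "u * k x + v * k x = k x" using u(3) by (metis distrib_right mult_1)
      then show ?thesis by (simp add: distrib_left)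
    qed
    finally show "u *\<^sub>R p + v *\<^sub>R q \<in> S" by (simp add: S_def)
  qed
  moreover have "0 \<notin> S" by (simp add: S_def)
  ultimately obtain a where a: "a \<noteq> 0" "\<And>p. p \<in> S \<Longrightarrow> 0 \<le> a \<bullet> p"
    using separating_hyperplane_set_0 by metis
  obtain b \<beta> where ab: "a = (b, \<beta>)" by (cases a)
  have ineq: "0 \<le> b \<bullet> v + \<beta> * r" if "k (x + v) < k x + r" for v r
    using a(2)[of "(v, r)"] that by (simp add: S_def ab)
  have "\<beta> \<ge> 0" using ineq[of 0 1] by simp
  \<comment> \<open>The hyperplane is not vertical because \<open>k\<close> is finite everywhere:
    every \<open>v\<close> is the first component of a point of \<open>S\<close>, so
    \<open>\<beta> = 0\<close> would force \<open>b = 0\<close>.\<close>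
  moreover have "\<beta> \<noteq> 0"
  proof
    assume "\<beta> = 0"
    then have "0 \<le> b \<bullet> v" for v using ineq[of v "k (x + v) - k x + 1"] by simp
    from this[of "- b"] have "\<not> 0 < b \<bullet> b" by (simp del: inner_gt_zero_iff)
    then have "b = 0" by (metis inner_gt_zero_iff)
    with \<open>\<beta> = 0\<close> ab a(1) show False by (simp add: zero_prod_def)
  qed
  ultimately have \<beta>: "\<beta> > 0" by simp
  have "k (x + v) \<ge> k x + (- (b /\<^sub>R \<beta>)) \<bullet> v" for v
  proof (rule field_le_epsilon)
    fix e :: real assume "e > 0"
    then have "0 \<le> b \<bullet> v + \<beta> * (k (x + v) - k x + e)" by (intro ineq) simp
    then show "k x + (- (b /\<^sub>R \<beta>)) \<bullet> v \<le> k (x + v) + e"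
      using \<beta> by (simp add: field_simps)
  qed
  then show ?thesis by blast
qed

text \<open>A subgradient gives an affine lower bound. Inserted for \<open>- v\<close> into the
  second-difference bound, it gives an upper bound with the same affine part and error
  \<open>C * (norm v)\<^sup>2\<close>. The two bounds pinch the derivative, and comparing them at
  two points gives the Lipschitz estimate.\<close>

lemma convex_on_second_difference_bound_imp_lipschitz_gradient:
  fixes k :: "'a::euclidean_space \<Rightarrow> real"
  assumes k: "convex_on UNIV k"
    and bound: "\<And>x v. k (x + v) + k (x - v) \<le> 2 * k x + C * (norm v)\<^sup>2"
    and "C \<ge> 0"
  shows "\<exists>\<xi>. (\<forall>x. (k has_derivative (\<lambda>v. \<xi> x \<bullet> v)) (at x)) \<and> (4 * C)-lipschitz_on UNIV \<xi>"
proof -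
  obtain \<xi> where low: "\<And>x v. k (x + v) \<ge> k x + \<xi> x \<bullet> v"
    using convex_on_subgradient[OF k] by metis
  have up: "k (x + v) \<le> k x + \<xi> x \<bullet> v + C * (norm v)\<^sup>2" for x v
    using low[of x "- v"] bound[of x v] by simp
  have "(k has_derivative (\<lambda>v. \<xi> x \<bullet> v)) (at x)" for x
    unfolding has_derivative_at
  proof (intro conjI)
    show "bounded_linear (\<lambda>v. \<xi> x \<bullet> v)" by (rule bounded_linear_inner_right)
    have "norm (norm (k (x + h) - k x - \<xi> x \<bullet> h) / norm h) \<le> C * norm h" for h
    proof (cases "h = 0")
      case False
      then show ?thesis using low[of x h] up[of x h]
        by (simp add: divide_le_eq power2_eq_square algebra_simps)
    qed simp
    moreover have "((\<lambda>h::'a. C * norm h) \<longlongrightarrow> 0) (at 0)"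
      by (rule tendsto_eq_intros refl | simp)+
    ultimately show "((\<lambda>h. norm (k (x + h) - k x - \<xi> x \<bullet> h) / norm h) \<longlongrightarrow> 0) (at 0)"
      by (rule Lim_null_comparison[OF always_eventually, OF allI])
  qed
  moreover have "(4 * C)-lipschitz_on UNIV \<xi>"
  proof (rule lipschitz_onI)
    fix x y :: 'a
    define w where "w = \<xi> y - \<xi> x"
    show "dist (\<xi> x) (\<xi> y) \<le> 4 * C * dist x y"
    proof (cases "w = 0")
      case True
      then show ?thesis using \<open>C \<ge> 0\<close> by (simp add: w_def)
    next
      case False
      \<comment> \<open>A step from \<open>y\<close> along the change of gradient, as long as
        \<open>dist x y\<close>. Then \<open>y - x + v\<close> has norm at most
        \<open>2 * dist x y\<close>, whose square is the origin of the factor 4.\<close>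
      define v where "v = (dist x y / norm w) *\<^sub>R w"
      have nv: "norm v = dist x y" using False by (simp add: v_def)
      have "\<xi> y \<bullet> v \<le> k (y + v) - k y" using low[of y v] by simp
      moreover have "k (y + v) \<le> k x + \<xi> x \<bullet> (y - x + v) + C * (norm (y - x + v))\<^sup>2"
        using up[of x "y - x + v"] by (simp add: algebra_simps)
      moreover have "k y \<ge> k x + \<xi> x \<bullet> (y - x)" using low[of x "y - x"] by simp
      ultimately have "w \<bullet> v \<le> C * (norm (y - x + v))\<^sup>2"
        by (simp add: w_def inner_simps)
      also have "norm (y - x + v) \<le> 2 * dist x y"
        using norm_triangle_ineq[of "y - x" v] nv by (simp add: dist_norm norm_minus_commute)
      then have "C * (norm (y - x + v))\<^sup>2 \<le> C * (2 * dist x y)\<^sup>2"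
        using \<open>C \<ge> 0\<close> by (intro mult_left_mono power_mono) auto
      finally have "w \<bullet> v \<le> C * (2 * dist x y)\<^sup>2" .
      moreover have "w \<bullet> v = dist x y * norm w"
        using False by (simp add: v_def power2_norm_eq_inner[symmetric] power2_eq_square)
      ultimately have "dist x y * norm w \<le> dist x y * (4 * C * dist x y)"
        by (simp add: power2_eq_square algebra_simps)
      moreover have "x \<noteq> y" using False by (auto simp: w_def)
      ultimately show ?thesis by (simp add: w_def dist_norm norm_minus_commute)
    qed
  qed (use \<open>C \<ge> 0\<close> in simp)
  ultimately show ?thesis by blast
qed

text \<open>The interpolant is the supremum of all minorants of the upper bound whose semiconvexity
  constant is \<open>2 \<alpha>\<close>. That class contains all the concave paraboloids below \<open>U\<close> and is stable under
  averaging two opposite translates and subtracting \<open>\<alpha> (norm v)\<^sup>2\<close>, whence the bound on second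
  differences.\<close>

lemma C11_between:
  fixes U V :: "'a::euclidean_space \<Rightarrow> real"
  assumes "P \<noteq> {}" and "\<alpha> \<ge> 0"
    and UV: "\<And>p q. p \<in> P \<Longrightarrow> q \<in> P \<Longrightarrow> U p - V q \<le> M + \<alpha> / 2 * (norm (p - q))\<^sup>2"
    and shift: "\<And>p. p + e \<in> P \<longleftrightarrow> p \<in> P"
      "\<And>p. p \<in> P \<Longrightarrow> V (p + e) = V p + b"
  shows "\<exists>\<phi> \<xi> L. (\<forall>x. (\<phi> has_derivative (\<lambda>v. \<xi> x \<bullet> v)) (at x)) \<and> L-lipschitz_on UNIV \<xi> \<and>
     (\<forall>z. \<phi> (z + e) = \<phi> z + b) \<and>
     (\<forall>p\<in>P. \<forall>z. U p \<le> \<phi> z + \<alpha> * (norm (p - z))\<^sup>2) \<and>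
     (\<forall>q\<in>P. \<forall>z. \<phi> z \<le> V q + M + \<alpha> * (norm (q - z))\<^sup>2)"
proof -
  define S where "S = {u. convex_on UNIV (\<lambda>z. u z + \<alpha> * (norm z)\<^sup>2) \<and>
     (\<forall>q\<in>P. \<forall>z. u z \<le> V q + M + \<alpha> * (norm (q - z))\<^sup>2)}"
  define \<phi> where "\<phi> = (\<lambda>z. SUP u\<in>S. u z)"
  have affine: "convex_on UNIV (\<lambda>z::'a. c \<bullet> z + d)" for c d
    by (rule convex_onI) (auto simp: inner_simps algebra_simps)
  have coneS: "(\<lambda>z. U p - \<alpha> * (norm (p - z))\<^sup>2) \<in> S" if p: "p \<in> P" for p
  proof -
    have "U p - \<alpha> * (norm (p - z))\<^sup>2 \<le> V q + M + \<alpha> * (norm (q - z))\<^sup>2" if q: "q \<in> P" for q z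
    proof -
      \<comment> \<open>Parallelogram law. The square that is then dropped vanishes exactly when
        \<open>z\<close> is the midpoint of \<open>p\<close> and \<open>q\<close>; this is why
        \<open>\<alpha> / 2\<close> in the hypothesis becomes \<open>\<alpha>\<close> in both
        conclusions.\<close>
      have "(norm (p - q))\<^sup>2 + (norm ((p - z) + (q - z)))\<^sup>2
          = 2 * (norm (p - z))\<^sup>2 + 2 * (norm (q - z))\<^sup>2"
        by (simp add: power2_norm_eq_inner inner_simps inner_commute)
      then have "(norm (p - q))\<^sup>2 / 2 \<le> (norm (p - z))\<^sup>2 + (norm (q - z))\<^sup>2"
        using zero_le_power2[of "norm ((p - z) + (q - z))"] by linarith
      then have "\<alpha> * ((norm (p - q))\<^sup>2 / 2) \<le> \<alpha> * ((norm (p - z))\<^sup>2 + (norm (q - z))\<^sup>2)"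
        using \<open>\<alpha> \<ge> 0\<close> by (rule mult_left_mono)
      then show ?thesis using UV[OF p q] by (simp add: algebra_simps)
    qed
    moreover have "(\<lambda>z. U p - \<alpha> * (norm (p - z))\<^sup>2 + \<alpha> * (norm z)\<^sup>2)
       = (\<lambda>z. ((2 * \<alpha>) *\<^sub>R p) \<bullet> z + (U p - \<alpha> * (norm p)\<^sup>2))"
      by (simp add: power2_norm_eq_inner inner_simps inner_commute algebra_simps)
    ultimately show ?thesis unfolding S_def using affine by (simp only: mem_Collect_eq) blast
  qed
  have "S \<noteq> {}" using coneS \<open>P \<noteq> {}\<close> by blast
  have bdd: "bdd_above ((\<lambda>u. u z) ` S)" for z
  proof -
    obtain q where "q \<in> P" using \<open>P \<noteq> {}\<close> by blast
    then show ?thesis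
      by (intro bdd_aboveI2[of _ _ "V q + M + \<alpha> * (norm (q - z))\<^sup>2"]) (auto simp: S_def)
  qed
  have upper: "u z \<le> \<phi> z" if "u \<in> S" for u z
    unfolding \<phi>_def using that by (intro cSUP_upper bdd)
  have least: "\<phi> z \<le> c" if "\<And>u. u \<in> S \<Longrightarrow> u z \<le> c" for z c
    unfolding \<phi>_def using that \<open>S \<noteq> {}\<close> by (intro cSUP_least)
  have \<phi>conv: "convex_on UNIV (\<lambda>z. \<phi> z + \<alpha> * (norm z)\<^sup>2)"
  proof (rule convex_onI)
    fix t :: real and x y :: 'a assume t: "0 < t" "t < 1"
    let ?w = "(1 - t) *\<^sub>R x + t *\<^sub>R y"
    have "\<phi> ?w \<le> (1 - t) * (\<phi> x + \<alpha> * (norm x)\<^sup>2) + t * (\<phi> y + \<alpha> * (norm y)\<^sup>2) - \<alpha> * (norm ?w)\<^sup>2"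
    proof (rule least)
      fix u assume u: "u \<in> S"
      then have "u ?w + \<alpha> * (norm ?w)\<^sup>2
          \<le> (1 - t) * (u x + \<alpha> * (norm x)\<^sup>2) + t * (u y + \<alpha> * (norm y)\<^sup>2)"
        using t convex_onD[of UNIV "\<lambda>z. u z + \<alpha> * (norm z)\<^sup>2" t x y] by (simp add: S_def)
      also have "\<dots> \<le> (1 - t) * (\<phi> x + \<alpha> * (norm x)\<^sup>2) + t * (\<phi> y + \<alpha> * (norm y)\<^sup>2)"
      proof -
        have le: "u w + \<alpha> * (norm w)\<^sup>2 \<le> \<phi> w + \<alpha> * (norm w)\<^sup>2" for w
          using upper[OF u] by simp
        show ?thesis using t by (intro add_mono mult_left_mono le) auto
      qed
      finally show "u ?w \<le> (1 - t) * (\<phi> x + \<alpha> * (norm x)\<^sup>2) + t * (\<phi> y + \<alpha> * (norm y)\<^sup>2)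
          - \<alpha> * (norm ?w)\<^sup>2" by simp
    qed
    then show "\<phi> ?w + \<alpha> * (norm ?w)\<^sup>2
        \<le> (1 - t) * (\<phi> x + \<alpha> * (norm x)\<^sup>2) + t * (\<phi> y + \<alpha> * (norm y)\<^sup>2)" by simp
  qed simp
  have \<phi>le: "\<phi> z \<le> V q + M + \<alpha> * (norm (q - z))\<^sup>2" if "q \<in> P" for q z
    using that by (intro least) (auto simp: S_def)
  \<comment> \<open>The squares of \<open>norm (z + w)\<close> and \<open>norm z\<close> differ by
    an affine function of \<open>z\<close>, so translation preserves the semiconvexity
    constant.\<close>
  have translate: "convex_on UNIV (\<lambda>z. u (z + w) + \<alpha> * (norm z)\<^sup>2)"
    if u: "convex_on UNIV (\<lambda>z. u z + \<alpha> * (norm z)\<^sup>2)" for u :: "'a \<Rightarrow> real" and w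
  proof -
    have "convex_on UNIV (\<lambda>z. u (z + w) + \<alpha> * (norm (z + w))\<^sup>2)"
    proof (rule convex_onI)
      fix t :: real and x y :: 'a assume t: "0 < t" "t < 1"
      have "(1 - t) *\<^sub>R x + t *\<^sub>R y + w = (1 - t) *\<^sub>R (x + w) + t *\<^sub>R (y + w)"
        by (simp add: algebra_simps)
      then show "u ((1 - t) *\<^sub>R x + t *\<^sub>R y + w) + \<alpha> * (norm ((1 - t) *\<^sub>R x + t *\<^sub>R y + w))\<^sup>2
          \<le> (1 - t) * (u (x + w) + \<alpha> * (norm (x + w))\<^sup>2) + t * (u (y + w) + \<alpha> * (norm (y + w))\<^sup>2)"
        using convex_onD[OF u, of t "x + w" "y + w"] t by simp
    qed simp
    from convex_on_add[OF this affine[of "- (2 * \<alpha>) *\<^sub>R w" "- \<alpha> * (norm w)\<^sup>2"]]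
    show ?thesis
      by (simp add: power2_norm_eq_inner inner_simps inner_commute algebra_simps)
  qed
  have \<phi>second: "\<phi> (z + v) + \<phi> (z - v) \<le> 2 * \<phi> z + 2 * \<alpha> * (norm v)\<^sup>2" for z v
  proof -
    define u where "u = (\<lambda>z. (\<phi> (z + v) + \<phi> (z + - v)) / 2 - \<alpha> * (norm v)\<^sup>2)"
    have "(\<lambda>z. u z + \<alpha> * (norm z)\<^sup>2) = (\<lambda>z. (1/2) * (\<phi> (z + v) + \<alpha> * (norm z)\<^sup>2) +
        ((1/2) * (\<phi> (z + - v) + \<alpha> * (norm z)\<^sup>2) + (0 \<bullet> z + - \<alpha> * (norm v)\<^sup>2)))"
      by (rule ext) (simp add: u_def field_simps)
    moreover have "convex_on UNIV (\<lambda>z. (1/2) * (\<phi> (z + v) + \<alpha> * (norm z)\<^sup>2) +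
        ((1/2) * (\<phi> (z + - v) + \<alpha> * (norm z)\<^sup>2) + (0 \<bullet> z + - \<alpha> * (norm v)\<^sup>2)))"
      by (intro convex_on_add convex_on_cmul translate \<phi>conv affine) auto
    ultimately have "convex_on UNIV (\<lambda>z. u z + \<alpha> * (norm z)\<^sup>2)" by (simp only:)
    moreover have "u w \<le> V q + M + \<alpha> * (norm (q - w))\<^sup>2" if q: "q \<in> P" for q w
    proof -
      \<comment> \<open>Averaging the upper bounds at the two translates costs
        \<open>\<alpha> * (norm v)\<^sup>2\<close>, exactly the amount subtracted in
        \<open>u\<close>.\<close>
      have "(norm (q - (w + v)))\<^sup>2 + (norm (q - (w + - v)))\<^sup>2
          = 2 * (norm (q - w))\<^sup>2 + 2 * (norm v)\<^sup>2"
        by (simp add: power2_norm_eq_inner inner_simps inner_commute)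
      then have "\<alpha> * (norm (q - (w + v)))\<^sup>2 + \<alpha> * (norm (q - (w + - v)))\<^sup>2
          = 2 * (\<alpha> * (norm (q - w))\<^sup>2) + 2 * (\<alpha> * (norm v)\<^sup>2)"
        by (metis (no_types, opaque_lifting) distrib_left mult.left_commute)
      then show ?thesis
        using \<phi>le[OF q, of "w + v"] \<phi>le[OF q, of "w + - v"] unfolding u_def by argo
    qed
    ultimately have "u \<in> S" by (simp add: S_def)
    from upper[OF this, of z] show ?thesis by (simp add: u_def field_simps)
  qed
  \<comment> \<open>A one-sided estimate for a general shift; applied to \<open>e\<close> and to
    \<open>- e\<close> it yields equality.\<close>
  have shift_ge: "\<phi> (z + w) \<le> \<phi> z + c"
    if w: "\<And>p. p + w \<in> P \<longleftrightarrow> p \<in> P" "\<And>p. p \<in> P \<Longrightarrow> V (p + w) = V p + c" for w c z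
  proof -
    define u where "u = (\<lambda>z. \<phi> (z + w) - c)"
    have "convex_on UNIV (\<lambda>z. (\<phi> (z + w) + \<alpha> * (norm z)\<^sup>2) + (0 \<bullet> z + - c))"
      by (intro convex_on_add translate \<phi>conv affine)
    then have "convex_on UNIV (\<lambda>z. u z + \<alpha> * (norm z)\<^sup>2)"
      by (simp add: u_def algebra_simps)
    moreover have "u y \<le> V q + M + \<alpha> * (norm (q - y))\<^sup>2" if q: "q \<in> P" for q y
      using \<phi>le[of "q + w" "y + w"] w q by (simp add: u_def)
    ultimately have "u \<in> S" by (simp add: S_def)
    from upper[OF this, of z] show ?thesis by (simp add: u_def)
  qed
  have shift': "p + - e \<in> P \<longleftrightarrow> p \<in> P" for p
    using shift(1)[of "p + - e"] by simp
  have "V (p + - e) = V p + - b" if "p \<in> P" for p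
    using shift(2)[of "p + - e"] that shift' by simp
  then have "\<phi> (z + e + - e) \<le> \<phi> (z + e) + - b" for z
    by (intro shift_ge shift')
  then have "\<phi> z + b \<le> \<phi> (z + e)" for z
    using add_diff_cancel_right'[of z e] by (metis add.commute add_le_cancel_left diff_conv_add_uminus le_diff_eq)
  moreover have "\<phi> (z + e) \<le> \<phi> z + b" for z by (rule shift_ge[OF shift])
  ultimately have \<phi>shift: "\<phi> (z + e) = \<phi> z + b" for z by (rule antisym[rotated])
  \<comment> \<open>The constant \<open>4 * \<alpha>\<close> is \<open>2 * \<alpha>\<close> from
    \<open>\<phi>second\<close> plus \<open>2 * \<alpha>\<close> from the second difference of the
    added square.\<close>
  have "\<phi> (z + v) + \<alpha> * (norm (z + v))\<^sup>2 + (\<phi> (z - v) + \<alpha> * (norm (z - v))\<^sup>2)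
      \<le> 2 * (\<phi> z + \<alpha> * (norm z)\<^sup>2) + 4 * \<alpha> * (norm v)\<^sup>2" for z v
    using \<phi>second[of z v]
    by (simp add: power2_norm_eq_inner inner_simps inner_commute algebra_simps)
  then obtain \<zeta> where \<zeta>: "\<And>x. ((\<lambda>z. \<phi> z + \<alpha> * (norm z)\<^sup>2) has_derivative (\<lambda>v. \<zeta> x \<bullet> v)) (at x)"
      "(4 * (4 * \<alpha>))-lipschitz_on UNIV \<zeta>"
    using convex_on_second_difference_bound_imp_lipschitz_gradient[OF \<phi>conv, of "4 * \<alpha>"]
      \<open>\<alpha> \<ge> 0\<close> by auto
  define \<xi> where "\<xi> = (\<lambda>x. \<zeta> x - (2 * \<alpha>) *\<^sub>R x)"
  have "(\<phi> has_derivative (\<lambda>v. \<xi> x \<bullet> v)) (at x)" for x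
  proof -
    have "((\<lambda>z. (\<phi> z + \<alpha> * (norm z)\<^sup>2) - \<alpha> * (z \<bullet> z)) has_derivative
        (\<lambda>v. \<zeta> x \<bullet> v - \<alpha> * (x \<bullet> v + v \<bullet> x))) (at x)"
      by (intro derivative_intros \<zeta>)
    then show ?thesis
      by (simp add: \<xi>_def power2_norm_eq_inner inner_simps inner_commute[of _ x] algebra_simps)
  qed
  moreover have "(4 * (4 * \<alpha>) + 2 * \<alpha>)-lipschitz_on UNIV \<xi>"
    unfolding \<xi>_def using \<open>\<alpha> \<ge> 0\<close>
    by (intro lipschitz_on_diff \<zeta> lipschitz_onI) (auto simp: dist_norm scaleR_diff_right[symmetric] simp del: scaleR_diff_right)
  moreover have "U p \<le> \<phi> z + \<alpha> * (norm (p - z))\<^sup>2" if "p \<in> P" for p z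
    using upper[OF coneS[OF that], of z] by simp
  ultimately show ?thesis using \<phi>shift \<phi>le by blast
qed


section \<open>Test functions\<close>

text \<open>Integrability is not assumed: where it fails, both integrals are \<open>0\<close> by convention and
  \<open>e = 0\<close>.\<close>

lemma A0_cos_perturbation:
  "\<exists>e. \<bar>e\<bar> \<le> \<bar>\<kappa>\<bar> \<and>
     A0 (\<lambda>x. f (x - b) + c + \<kappa> * (1 - cos (x - a))) a = A0 f (a - b) + e"
proof -
  define I where "I h = (2 * f (a - b) - f (a - b - h) - f (a - b + h)) / (sin (h / 2))\<^sup>2" for h
  define J where "J h = (2 - 2 * cos h) / (sin (h / 2))\<^sup>2" for h :: real
  define K where "K h = I h - \<kappa> * J h" for h
  \<comment> \<open>\<open>- \<kappa> * J\<close> is the contribution of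
    \<open>\<kappa> * (1 - cos (x - a))\<close> to the integrand. The half-angle formula makes
    \<open>J\<close> constant off 0, and division by zero gives \<open>J 0 = 0\<close>, so the
    integrals are compared almost everywhere.\<close>
  have J: "J h = 4" if "h \<in> {-pi..pi}" "h \<noteq> 0" for h
  proof -
    have "sin (h / 2) \<noteq> 0"
    proof (cases "h > 0")
      case True
      then have "sin (h / 2) > 0" using that by (intro sin_gt_zero) auto
      then show ?thesis by simp
    next
      case False
      then have "sin (- h / 2) > 0" using that by (intro sin_gt_zero) auto
      then show ?thesis by simp
    qed
    moreover have "cos h = 1 - 2 * (sin (h / 2))\<^sup>2"
      using cos_double_sin[of "h / 2"] by simp
    ultimately show ?thesis by (simp add: J_def field_simps)
  qed
  have [measurable]: "J \<in> borel_measurable borel" unfolding J_def by measurable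
  have const: "set_integrable lborel {-pi..pi} (\<lambda>h. 4 :: real)"
    by (intro borel_integrable_atLeastAtMost' continuous_intros)
  have ae: "AE h in lborel. indicator {-pi..pi} h *\<^sub>R J h = indicator {-pi..pi} h *\<^sub>R (4 :: real)"
    using AE_lborel_singleton[of 0] by eventually_elim (auto simp: J indicator_def)
  have Jint: "set_integrable lborel {-pi..pi} J"
    unfolding set_integrable_def
    by (subst integrable_cong_AE[OF _ _ ae]) (use const in \<open>auto simp: set_integrable_def\<close>)
  have "(LINT h:{-pi..pi}|lborel. J h) = (LINT h:{-pi..pi}|lborel. 4)"
    unfolding set_lebesgue_integral_def by (intro integral_cong_AE ae) auto
  also have "\<dots> = 8 * pi" by (simp add: set_integral_const)
  finally have Jval: "(LINT h:{-pi..pi}|lborel. J h) = 8 * pi" .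
  have lhs: "A0 (\<lambda>x. f (x - b) + c + \<kappa> * (1 - cos (x - a))) a
      = 1 / (8 * pi) * (LINT h:{-pi..pi}|lborel. K h)"
    unfolding A0_def K_def I_def J_def
    by (simp add: algebra_simps diff_divide_distrib[symmetric] add_divide_distrib[symmetric])
  have rhs: "A0 f (a - b) = 1 / (8 * pi) * (LINT h:{-pi..pi}|lborel. I h)"
    unfolding A0_def I_def ..
  show ?thesis
  proof (cases "set_integrable lborel {-pi..pi} I")
    case True
    then have "(LINT h:{-pi..pi}|lborel. K h) = (LINT h:{-pi..pi}|lborel. I h) - \<kappa> * (8 * pi)"
      unfolding K_def using Jint by (simp add: set_integral_diff Jval)
    then show ?thesis
      unfolding lhs rhs by (intro exI[of _ "- \<kappa>"]) (simp add: field_simps)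
  next
    case False
    have "\<not> set_integrable lborel {-pi..pi} K"
    proof
      assume "set_integrable lborel {-pi..pi} K"
      then have "set_integrable lborel {-pi..pi} (\<lambda>h. K h + \<kappa> * J h)"
        using Jint by (intro set_integral_add) auto
      with False show False by (simp add: K_def)
    qed
    with False have "(LINT h:{-pi..pi}|lborel. K h) = 0" "(LINT h:{-pi..pi}|lborel. I h) = 0"
      by (simp_all add: set_lebesgue_integral_def set_integrable_def not_integrable_integral_eq)
    then show ?thesis unfolding lhs rhs by (intro exI[of _ 0]) simp
  qed
qed

lemma has_derivative_imp_partials:
  fixes \<psi> :: "real \<times> real \<Rightarrow> real"
  assumes "(\<psi> has_derivative (\<lambda>v. \<Xi> \<bullet> v)) (at p)"
  shows "partial_t \<psi> p = fst \<Xi>" and "partial_x \<psi> p = snd \<Xi>"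
proof -
  obtain t x where p: "p = (t, x)" by (cases p)
  have "((\<lambda>s. \<psi> (s, x)) has_derivative (\<lambda>h. \<Xi> \<bullet> (h, 0))) (at t)"
    using assms unfolding p by (rule has_derivative_compose[rotated]) (auto intro!: derivative_eq_intros)
  then have "((\<lambda>s. \<psi> (s, x)) has_field_derivative fst \<Xi>) (at t)"
    by (simp add: has_field_derivative_def inner_prod_def mult_commute_abs)
  then show "partial_t \<psi> p = fst \<Xi>" by (simp add: partial_t_def p DERIV_imp_deriv)
  have "((\<lambda>y. \<psi> (t, y)) has_derivative (\<lambda>h. \<Xi> \<bullet> (0, h))) (at x)"
    using assms unfolding p by (rule has_derivative_compose[rotated]) (auto intro!: derivative_eq_intros)
  then have "((\<lambda>y. \<psi> (t, y)) has_field_derivative snd \<Xi>) (at x)"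
    by (simp add: has_field_derivative_def inner_prod_def mult_commute_abs)
  then show "partial_x \<psi> p = snd \<Xi>" by (simp add: partial_x_def p DERIV_imp_deriv)
qed

lemma C11_spaceI:
  assumes D: "\<And>p. (\<psi> has_derivative (\<lambda>v. \<Xi> p \<bullet> v)) (at p)"
    and "continuous_on UNIV \<Xi>" and "L-lipschitz_on UNIV (\<lambda>p. snd (\<Xi> p))"
    and "\<And>t x. \<psi> (t, x + 2 * pi) = \<psi> (t, x) + b"
  shows "\<psi> \<in> C11_space"
proof -
  have "C1_on half_space \<psi>"
    unfolding C1_on_def
  proof (intro exI conjI ballI)
    show "(\<psi> has_derivative blinfun_apply (blinfun_inner_right (\<Xi> p))) (at p within half_space)" for p
      using has_derivative_at_withinI[OF D] by (simp add: blinfun_inner_right.rep_eq)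
    show "continuous_on half_space (\<lambda>p. blinfun_inner_right (\<Xi> p))"
      by (intro bounded_linear.continuous_on[OF bounded_linear_blinfun_inner_right]
          continuous_on_subset[OF assms(2)]) simp
  qed
  moreover have "L-lipschitz_on half_space (partial_x \<psi>)"
    using assms(3) has_derivative_imp_partials(2)[OF D] by (auto simp: lipschitz_on_def)
  ultimately show ?thesis using assms(4) unfolding C11_space_def F_space_def by blast
qed

text \<open>The perturbation vanishes with its gradient at \<open>(t0, x0)\<close>, so there only
  the half-Laplacian sees it. Space enters through a cosine because test functions must be
  quasi-periodic, and for nonzero \<open>\<kappa>\<close> the zeros of the perturbation are
  precisely the contact points that a strict extremum admits. The shift \<open>d\<close> allows one
  \<open>\<phi>\<close> to be used at two different points.\<close>

lemma strict_touching_test_function: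
  fixes \<phi> :: "real \<times> real \<Rightarrow> real" and t0 x0 c \<kappa> :: real
  assumes D: "\<And>p. (\<phi> has_derivative (\<lambda>v. \<xi> p \<bullet> v)) (at p)"
    and Lip: "L-lipschitz_on UNIV \<xi>"
    and shift: "\<And>p. \<phi> (p + (0, 2 * pi)) = \<phi> p + b"
    and G: "\<And>t. (G has_real_derivative G' t) (at t)" "continuous_on UNIV G'"
    and z: "z = (t0, x0) - d"
  defines "\<psi> \<equiv> \<lambda>p. \<phi> (p - d) + G (fst p) + c + \<kappa> * ((fst p - t0)\<^sup>2 + (1 - cos (snd p - x0)))"
  shows "\<psi> \<in> C11_space" and "partial_x \<psi> (t0, x0) = snd (\<xi> z)"
    and "\<exists>e. \<bar>e\<bar> \<le> \<bar>\<kappa>\<bar> \<and> pde_lhs \<psi> (t0, x0) = fst (\<xi> z) + G' t0 +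
      1 / pi * (arctan ((A0 (\<lambda>x. \<phi> (fst z, x)) (snd z) + e) / max (snd (\<xi> z)) 0) + pi / 2)"
proof -
  define \<Xi> where "\<Xi> p = \<xi> (p - d) + (G' (fst p) + \<kappa> * (2 * (fst p - t0)), \<kappa> * sin (snd p - x0))" for p
  have D\<psi>: "(\<psi> has_derivative (\<lambda>v. \<Xi> p \<bullet> v)) (at p)" for p
  proof -
    have "((\<lambda>p. \<phi> (p - d)) has_derivative (\<lambda>v. \<xi> (p - d) \<bullet> v)) (at p)"
      by (rule has_derivative_compose[OF _ D]) (auto intro!: derivative_eq_intros)
    moreover have "((\<lambda>p. G (fst p)) has_derivative (\<lambda>v. G' (fst p) * fst v)) (at p)"
      using G(1) unfolding has_field_derivative_def
      by (rule has_derivative_compose[rotated]) (auto intro!: derivative_eq_intros)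
    moreover have "((\<lambda>p. \<kappa> * ((fst p - t0)\<^sup>2 + (1 - cos (snd p - x0)))) has_derivative
        (\<lambda>v. \<kappa> * (2 * (fst p - t0) * fst v + sin (snd p - x0) * snd v))) (at p)"
      by (auto intro!: derivative_eq_intros simp: algebra_simps)
    ultimately have "(\<psi> has_derivative (\<lambda>v. \<xi> (p - d) \<bullet> v + G' (fst p) * fst v + 0 +
        \<kappa> * (2 * (fst p - t0) * fst v + sin (snd p - x0) * snd v))) (at p)"
      unfolding \<psi>_def by (intro has_derivative_add has_derivative_const)
    then show ?thesis
      by (simp add: \<Xi>_def inner_add_left inner_prod_def algebra_simps)
  qed
  have "continuous_on UNIV (\<lambda>p. \<xi> (p - d))"
    by (rule continuous_on_compose2[OF lipschitz_on_continuous_on[OF Lip]])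
      (auto intro!: continuous_intros)
  moreover have "continuous_on UNIV (\<lambda>p::real \<times> real. G' (fst p))"
    by (rule continuous_on_compose2[OF G(2)]) (auto intro!: continuous_intros)
  ultimately have "continuous_on UNIV \<Xi>"
    unfolding \<Xi>_def by (intro continuous_intros)
  moreover have "(L + \<bar>\<kappa>\<bar>)-lipschitz_on UNIV (\<lambda>p. snd (\<Xi> p))"
  proof (rule lipschitz_onI)
    fix p q :: "real \<times> real"
    have "dist (snd (\<xi> (p - d))) (snd (\<xi> (q - d))) \<le> dist (\<xi> (p - d)) (\<xi> (q - d))"
      by (rule dist_snd_le)
    also have "\<dots> \<le> L * dist p q"
      using lipschitz_onD[OF Lip, of "p - d" "q - d"] by (simp add: dist_norm)
    finally have 1: "\<bar>snd (\<xi> (p - d)) - snd (\<xi> (q - d))\<bar> \<le> L * dist p q"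
      by (simp add: dist_real_def)
    have "\<bar>sin (snd p - x0) - sin (snd q - x0)\<bar> \<le> \<bar>snd p - snd q\<bar>"
      using sin_diff_sin[of "snd p - x0" "snd q - x0"]
        abs_sin_x_le_abs_x[of "(snd p - snd q) / 2"]
        mult_mono[OF abs_sin_x_le_abs_x[of "(snd p - snd q) / 2"] abs_cos_le_one[of "(snd p - x0 + (snd q - x0)) / 2"]]
      by (simp add: abs_mult)
    also have "\<dots> \<le> dist p q" using dist_snd_le[of p q] by (simp add: dist_real_def)
    finally have 2: "\<bar>\<kappa>\<bar> * \<bar>sin (snd p - x0) - sin (snd q - x0)\<bar> \<le> \<bar>\<kappa>\<bar> * dist p q"
      by (intro mult_left_mono) auto
    have "snd (\<Xi> p) - snd (\<Xi> q) = (snd (\<xi> (p - d)) - snd (\<xi> (q - d))) +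
        \<kappa> * (sin (snd p - x0) - sin (snd q - x0))"
      by (simp add: \<Xi>_def algebra_simps)
    then have "\<bar>snd (\<Xi> p) - snd (\<Xi> q)\<bar> \<le> \<bar>snd (\<xi> (p - d)) - snd (\<xi> (q - d))\<bar> +
        \<bar>\<kappa>\<bar> * \<bar>sin (snd p - x0) - sin (snd q - x0)\<bar>"
      by (metis abs_mult abs_triangle_ineq)
    then show "dist (snd (\<Xi> p)) (snd (\<Xi> q)) \<le> (L + \<bar>\<kappa>\<bar>) * dist p q"
      using 1 2 by (simp add: dist_real_def algebra_simps)
  next
    show "0 \<le> L + \<bar>\<kappa>\<bar>" using lipschitz_on_nonneg[OF Lip] by simp
  qed
  moreover have "\<psi> (t, x + 2 * pi) = \<psi> (t, x) + b" for t x
  proof -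
    have "(t, x + 2 * pi) - d = ((t, x) - d) + (0, 2 * pi)" by (simp add: prod_eq_iff)
    then have "\<phi> ((t, x + 2 * pi) - d) = \<phi> ((t, x) - d) + b" using shift by metis
    moreover have "cos (x + 2 * pi - x0) = cos (x - x0)"
      using cos_periodic[of "x - x0"] by (simp add: algebra_simps)
    ultimately show ?thesis by (simp add: \<psi>_def)
  qed
  ultimately show "\<psi> \<in> C11_space" by (intro C11_spaceI[OF D\<psi>])
  show px: "partial_x \<psi> (t0, x0) = snd (\<xi> z)"
    using has_derivative_imp_partials(2)[OF D\<psi>, of "(t0, x0)"] by (simp add: \<Xi>_def z)
  have pt: "partial_t \<psi> (t0, x0) = fst (\<xi> z) + G' t0"
    using has_derivative_imp_partials(1)[OF D\<psi>, of "(t0, x0)"] by (simp add: \<Xi>_def z)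
  obtain e where e: "\<bar>e\<bar> \<le> \<bar>\<kappa>\<bar>"
    "A0 (\<lambda>x. \<phi> (fst z, x - snd d) + (G t0 + c) + \<kappa> * (1 - cos (x - x0))) x0
      = A0 (\<lambda>x. \<phi> (fst z, x)) (x0 - snd d) + e"
    using A0_cos_perturbation[of \<kappa> "\<lambda>x. \<phi> (fst z, x)" "snd d" "G t0 + c" x0] by blast
  have "(\<lambda>x. \<psi> (t0, x)) = (\<lambda>x. \<phi> (fst z, x - snd d) + (G t0 + c) + \<kappa> * (1 - cos (x - x0)))"
    by (auto simp: \<psi>_def z minus_prod_def)
  with e(2) have "A0 (\<lambda>x. \<psi> (t0, x)) x0 = A0 (\<lambda>x. \<phi> (fst z, x)) (snd z) + e"
    by (simp add: z)
  then show "\<exists>e. \<bar>e\<bar> \<le> \<bar>\<kappa>\<bar> \<and> pde_lhs \<psi> (t0, x0) = fst (\<xi> z) + G' t0 +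
      1 / pi * (arctan ((A0 (\<lambda>x. \<phi> (fst z, x)) (snd z) + e) / max (snd (\<xi> z)) 0) + pi / 2)"
    using e(1) pt px by (intro exI[of _ e]) (simp add: pde_lhs_def)
qed

lemma square_plus_one_minus_cos_eq_0:
  assumes "(t - t0)\<^sup>2 + (1 - cos (x - x0)) = 0"
  shows "\<exists>k::int. (t, x) = (t0, x0 + 2 * pi * of_int k)"
proof -
  have "cos (x - x0) \<le> 1" by simp
  with assms have "cos (x - x0) = 1" "(t - t0)\<^sup>2 = 0"
    using zero_le_power2[of "t - t0"] by linarith+
  then obtain k :: int where "x - x0 = of_int k * 2 * pi"
    using cos_one_2pi_int by blast
  with \<open>(t - t0)\<^sup>2 = 0\<close> show ?thesis
    by (intro exI[of _ k]) (simp add: algebra_simps)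
qed

text \<open>Non-strict contact suffices: a positive multiple of the perturbation makes the maximum
  strict, at the price of an error \<open>e\<close> in the half-Laplacian. Since
  \<open>\<kappa>\<close> is free, it can later be chosen in proportion to the slope that divides
  \<open>e\<close>.\<close>

lemma subsolution_touching:
  assumes U: "viscosity_subsolution U"
    and D: "\<And>p. (\<phi> has_derivative (\<lambda>v. \<xi> p \<bullet> v)) (at p)"
    and Lip: "L-lipschitz_on UNIV \<xi>"
    and shift: "\<And>p. \<phi> (p + (0, 2 * pi)) = \<phi> p + b"
    and G: "\<And>t. (G has_real_derivative G' t) (at t)" "continuous_on UNIV G'"
    and z: "z = (t0, x0) - d"
    and above: "\<And>p. p \<in> half_space \<Longrightarrow> U p \<le> \<phi> (p - d) + G (fst p) + c"
    and touch: "U (t0, x0) = \<phi> z + G t0 + c"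
    and "t0 > 0" "snd (\<xi> z) \<noteq> 0" "\<kappa> > 0"
  shows "\<exists>e. \<bar>e\<bar> \<le> \<kappa> \<and> fst (\<xi> z) + G' t0 +
      1 / pi * (arctan ((A0 (\<lambda>x. \<phi> (fst z, x)) (snd z) + e) / max (snd (\<xi> z)) 0) + pi / 2) \<le> 0"
proof -
  define \<psi> where "\<psi> = (\<lambda>p. \<phi> (p - d) + G (fst p) + c + \<kappa> * ((fst p - t0)\<^sup>2 + (1 - cos (snd p - x0))))"
  note test = strict_touching_test_function[OF D Lip shift G z, where c = c and \<kappa> = \<kappa>, folded \<psi>_def]
  have zero: "U (t0, x0) - \<psi> (t0, x0) = 0" using touch by (simp add: \<psi>_def z)
  have le: "U p - \<psi> p \<le> - (\<kappa> * ((fst p - t0)\<^sup>2 + (1 - cos (snd p - x0))))"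
    if "p \<in> half_space" for p
    using above[OF that] by (simp add: \<psi>_def)
  have nn: "0 \<le> \<kappa> * ((fst p - t0)\<^sup>2 + (1 - cos (snd p - x0)))" for p
    using \<open>\<kappa> > 0\<close> by simp
  have "strict_max_at (\<lambda>p. U p - \<psi> p) (t0, x0)"
    unfolding strict_max_at_def prod.case zero
  proof (intro conjI ballI impI)
    fix p assume p: "p \<in> half_space"
    then show "U p - \<psi> p \<le> 0" using le[OF p] nn[of p] by linarith
    assume "U p - \<psi> p = 0"
    then have "\<kappa> * ((fst p - t0)\<^sup>2 + (1 - cos (snd p - x0))) = 0"
      using le[OF p] nn[of p] by linarith
    then show "\<exists>k::int. p = (t0, x0 + 2 * pi * of_int k)"
      using square_plus_one_minus_cos_eq_0[of "fst p" t0 "snd p" x0] \<open>\<kappa> > 0\<close> by simp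
  qed
  then have "pde_lhs \<psi> (t0, x0) \<le> 0"
    using U test(1,2) \<open>t0 > 0\<close> \<open>snd (\<xi> z) \<noteq> 0\<close> unfolding viscosity_subsolution_def by auto
  then show ?thesis using test(3) \<open>\<kappa> > 0\<close> by auto
qed

lemma supersolution_touching:
  assumes V: "viscosity_supersolution V"
    and D: "\<And>p. (\<phi> has_derivative (\<lambda>v. \<xi> p \<bullet> v)) (at p)"
    and Lip: "L-lipschitz_on UNIV \<xi>"
    and shift: "\<And>p. \<phi> (p + (0, 2 * pi)) = \<phi> p + b"
    and G: "\<And>t. (G has_real_derivative G' t) (at t)" "continuous_on UNIV G'"
    and z: "z = (t0, x0) - d"
    and below: "\<And>p. p \<in> half_space \<Longrightarrow> \<phi> (p - d) + G (fst p) + c \<le> V p"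
    and touch: "V (t0, x0) = \<phi> z + G t0 + c"
    and "t0 > 0" "snd (\<xi> z) \<noteq> 0" "\<kappa> > 0"
  shows "\<exists>e. \<bar>e\<bar> \<le> \<kappa> \<and> fst (\<xi> z) + G' t0 +
      1 / pi * (arctan ((A0 (\<lambda>x. \<phi> (fst z, x)) (snd z) + e) / max (snd (\<xi> z)) 0) + pi / 2) \<ge> 0"
proof -
  define \<psi> where "\<psi> = (\<lambda>p. \<phi> (p - d) + G (fst p) + c + (- \<kappa>) * ((fst p - t0)\<^sup>2 + (1 - cos (snd p - x0))))"
  note test = strict_touching_test_function[OF D Lip shift G z, where c = c and \<kappa> = "- \<kappa>", folded \<psi>_def]
  have zero: "V (t0, x0) - \<psi> (t0, x0) = 0" using touch by (simp add: \<psi>_def z)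
  have le: "\<kappa> * ((fst p - t0)\<^sup>2 + (1 - cos (snd p - x0))) \<le> V p - \<psi> p"
    if "p \<in> half_space" for p
    using below[OF that] by (simp add: \<psi>_def)
  have nn: "0 \<le> \<kappa> * ((fst p - t0)\<^sup>2 + (1 - cos (snd p - x0)))" for p
    using \<open>\<kappa> > 0\<close> by simp
  have "strict_min_at (\<lambda>p. V p - \<psi> p) (t0, x0)"
    unfolding strict_min_at_def prod.case zero
  proof (intro conjI ballI impI)
    fix p assume p: "p \<in> half_space"
    then show "0 \<le> V p - \<psi> p" using le[OF p] nn[of p] by linarith
    assume "V p - \<psi> p = 0"
    then have "\<kappa> * ((fst p - t0)\<^sup>2 + (1 - cos (snd p - x0))) = 0"
      using le[OF p] nn[of p] by linarith
    then show "\<exists>k::int. p = (t0, x0 + 2 * pi * of_int k)"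
      using square_plus_one_minus_cos_eq_0[of "fst p" t0 "snd p" x0] \<open>\<kappa> > 0\<close> by simp
  qed
  then have "pde_lhs \<psi> (t0, x0) \<ge> 0"
    using V test(1,2) \<open>t0 > 0\<close> \<open>snd (\<xi> z) \<noteq> 0\<close> unfolding viscosity_supersolution_def by auto
  then show ?thesis using test(3) \<open>\<kappa> > 0\<close> by auto
qed

text \<open>If the slope were below \<open>m\<close>, then a little to the right of the contact
  point \<open>\<phi>\<close> would rise by less than \<open>m * h\<close>, whereas
  \<open>U\<close>, which stays below it, rises by at least \<open>m * h\<close>.\<close>

lemma touching_above_imp_slope_ge:
  fixes \<phi> :: "real \<times> real \<Rightarrow> real"
  assumes D: "(\<phi> has_derivative (\<lambda>v. \<xi> \<bullet> v)) (at z)"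
    and grow: "space_growth m U" and "t0 \<ge> 0"
    and above: "\<And>p. p \<in> half_space \<Longrightarrow> U p \<le> \<phi> (p - d) + g (fst p)"
    and touch: "U (t0, x0) = \<phi> z + g t0" and z: "z = (t0, x0) - d"
  shows "m \<le> snd \<xi>"
proof (rule ccontr)
  assume neg: "\<not> m \<le> snd \<xi>"
  have "((\<lambda>h. \<phi> (z + (0, h))) has_derivative (\<lambda>h. \<xi> \<bullet> (0, h))) (at 0)"
    by (rule has_derivative_compose[of _ "\<lambda>h. (0, h)"])
      (use D in \<open>auto intro!: derivative_eq_intros simp: zero_prod_def[symmetric]\<close>)
  then have "((\<lambda>h. \<phi> (z + (0, h))) has_real_derivative snd \<xi>) (at 0)"
    by (simp add: has_field_derivative_def inner_prod_def mult_commute_abs)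
  then have "((\<lambda>h. \<phi> (z + (0, h)) - m * h) has_real_derivative (snd \<xi> - m)) (at 0)"
    by (auto intro!: derivative_eq_intros)
  from DERIV_neg_dec_right[OF this] neg obtain \<delta> where "\<delta> > 0" and
    dec: "\<And>h. h > 0 \<Longrightarrow> h < \<delta> \<Longrightarrow> \<phi> (z + (0, h)) - m * h < \<phi> (z + (0, 0))"
    by auto
  define h where "h = \<delta> / 2"
  have h: "h > 0" "h < \<delta>" using \<open>\<delta> > 0\<close> by (auto simp: h_def)
  have "U (t0, x0 + h) \<le> \<phi> ((t0, x0 + h) - d) + g t0"
    using above[of "(t0, x0 + h)"] \<open>t0 \<ge> 0\<close> by (simp add: half_space_def)
  also have "(t0, x0 + h) - d = z + (0, h)" by (simp add: z prod_eq_iff)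
  finally have "U (t0, x0 + h) - U (t0, x0) \<le> \<phi> (z + (0, h)) - \<phi> z" using touch by simp
  moreover have "m * h \<le> U (t0, x0 + h) - U (t0, x0)"
    using grow \<open>t0 \<ge> 0\<close> h by (simp add: space_growth_def)
  ultimately show False using dec[OF h] by (simp add: zero_prod_def[symmetric])
qed


section \<open>Doubling of variables\<close>

lemma eventually_nhds_within:
  "eventually P (nhds_within x \<Omega>) \<longleftrightarrow> (\<exists>S. open S \<and> x \<in> S \<and> (\<forall>y\<in>S. y \<in> \<Omega> \<longrightarrow> P y))"
  by (simp add: nhds_within_def eventually_inf_principal eventually_nhds)

lemma usc_on_iff:
  "usc_on \<Omega> f \<longleftrightarrow> (\<forall>x\<in>\<Omega>. \<forall>c>f x. \<forall>\<^sub>F y in nhds_within x \<Omega>. f y < c)"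
proof (intro iffI ballI allI impI)
  fix x c assume "usc_on \<Omega> f" "x \<in> \<Omega>" "f x < c"
  then have "Limsup (nhds_within x \<Omega>) (\<lambda>y. ereal (f y)) \<le> ereal (f x)" "ereal (f x) < ereal c"
    by (simp_all add: usc_on_def)
  then have "Limsup (nhds_within x \<Omega>) (\<lambda>y. ereal (f y)) < ereal c" by (rule le_less_trans)
  from Limsup_lessD[OF this] show "\<forall>\<^sub>F y in nhds_within x \<Omega>. f y < c" by simp
next
  assume *: "\<forall>x\<in>\<Omega>. \<forall>c>f x. \<forall>\<^sub>F y in nhds_within x \<Omega>. f y < c"
  show "usc_on \<Omega> f"
    unfolding usc_on_def
  proof (rule ballI, rule ereal_le_epsilon2)
    fix x e assume x: "x \<in> \<Omega>" and "(0::real) < e"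
    then have "\<forall>\<^sub>F y in nhds_within x \<Omega>. f y < f x + e" using * by simp
    then have "Limsup (nhds_within x \<Omega>) (\<lambda>y. ereal (f y)) \<le> ereal (f x + e)"
      by (intro Limsup_bounded) (auto elim: eventually_mono)
    then show "Limsup (nhds_within x \<Omega>) (\<lambda>y. ereal (f y)) \<le> ereal (f x) + ereal e" by simp
  qed
qed

lemma lsc_on_iff_usc_on: "lsc_on \<Omega> f \<longleftrightarrow> usc_on \<Omega> (\<lambda>x. - f x)"
proof -
  have "Limsup F (\<lambda>y. ereal (- f y)) = - Liminf F (\<lambda>y. ereal (f y))" for F
    using ereal_Limsup_uminus[of F "\<lambda>y. ereal (f y)"] by simp
  then show ?thesis unfolding lsc_on_def usc_on_def
    by (simp add: ereal_uminus_le_reorder flip: uminus_ereal.simps)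
qed

lemma usc_on_add:
  assumes "usc_on \<Omega> f" "usc_on \<Omega> g"
  shows "usc_on \<Omega> (\<lambda>x. f x + g x)"
  unfolding usc_on_iff
proof (intro ballI allI impI)
  fix x c assume x: "x \<in> \<Omega>" and c: "f x + g x < c"
  define r where "r = (c - (f x + g x)) / 2"
  have "\<forall>\<^sub>F y in nhds_within x \<Omega>. f y < f x + r" "\<forall>\<^sub>F y in nhds_within x \<Omega>. g y < g x + r"
    using assms x c by (auto simp: usc_on_iff r_def)
  then show "\<forall>\<^sub>F y in nhds_within x \<Omega>. f y + g y < c"
    by eventually_elim (simp add: r_def field_simps)
qed

lemma usc_on_compose:
  assumes f: "usc_on \<Omega> f" and h: "continuous_on \<Omega>' h" "h ` \<Omega>' \<subseteq> \<Omega>"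
  shows "usc_on \<Omega>' (\<lambda>x. f (h x))"
  unfolding usc_on_iff eventually_nhds_within
proof (intro ballI allI impI)
  fix x c assume x: "x \<in> \<Omega>'" and c: "f (h x) < c"
  then have "\<forall>\<^sub>F y in nhds_within (h x) \<Omega>. f y < c"
    using f h(2) unfolding usc_on_iff by blast
  then obtain S where S: "open S" "h x \<in> S" "\<forall>y\<in>S. y \<in> \<Omega> \<longrightarrow> f y < c"
    unfolding eventually_nhds_within by blast
  obtain A where "open A" "x \<in> A" "\<forall>y\<in>\<Omega>'. y \<in> A \<longrightarrow> h y \<in> S"
    using h(1)[unfolded continuous_on_topological, rule_format, OF x S(1,2)] by blast
  then show "\<exists>S. open S \<and> x \<in> S \<and> (\<forall>y\<in>S. y \<in> \<Omega>' \<longrightarrow> f (h y) < c)"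
    using S h(2) by (intro exI[of _ A]) blast
qed

lemma usc_on_subset: "usc_on \<Omega> f \<Longrightarrow> \<Omega>' \<subseteq> \<Omega> \<Longrightarrow> usc_on \<Omega>' f"
  using usc_on_compose[of \<Omega> f \<Omega>' "\<lambda>x. x"] by simp

lemma continuous_imp_usc_on:
  assumes "continuous_on \<Omega> f"
  shows "usc_on \<Omega> f"
  unfolding usc_on_iff eventually_nhds_within
proof (intro ballI allI impI)
  fix x c assume "x \<in> \<Omega>" and "f x < c"
  then obtain A where "open A" "x \<in> A" "\<forall>y\<in>\<Omega>. y \<in> A \<longrightarrow> f y \<in> {..<c}"
    using assms[unfolded continuous_on_topological, rule_format, of x "{..<c}"] by auto
  then show "\<exists>S. open S \<and> x \<in> S \<and> (\<forall>y\<in>S. y \<in> \<Omega> \<longrightarrow> f y < c)" by auto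
qed

text \<open>Without a maximum, each \<open>x\<close> has a better point \<open>g x\<close> and a
  neighbourhood on which \<open>f\<close> is below \<open>f (g x)\<close>. For a finite subcover,
  the largest of these bounds would be exceeded by a later one.\<close>

lemma usc_on_attains_sup:
  assumes "compact K" "K \<noteq> {}" "usc_on K f"
  shows "\<exists>x\<in>K. \<forall>y\<in>K. f y \<le> f x"
proof (rule ccontr)
  assume "\<not> ?thesis"
  then obtain g where g: "\<And>x. x \<in> K \<Longrightarrow> g x \<in> K" "\<And>x. x \<in> K \<Longrightarrow> f x < f (g x)"
    by (metis not_le)
  then have "\<forall>x\<in>K. \<exists>S. open S \<and> x \<in> S \<and> (\<forall>y\<in>S. y \<in> K \<longrightarrow> f y < f (g x))"
    using assms(3) unfolding usc_on_iff eventually_nhds_within by blast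
  then obtain S where S: "\<And>x. x \<in> K \<Longrightarrow> open (S x)" "\<And>x. x \<in> K \<Longrightarrow> x \<in> S x"
    "\<And>x y. x \<in> K \<Longrightarrow> y \<in> S x \<Longrightarrow> y \<in> K \<Longrightarrow> f y < f (g x)"
    by metis
  obtain D where D: "D \<subseteq> K" "finite D" "K \<subseteq> (\<Union>x\<in>D. S x)"
    by (rule compactE_image[OF assms(1), of K S]) (use S in auto)
  then have "D \<noteq> {}" using assms(2) by auto
  then have "Max ((\<lambda>x. f (g x)) ` D) \<in> (\<lambda>x. f (g x)) ` D"
    using D(2) by (intro Max_in) auto
  then obtain x where "x \<in> D" and eq: "Max ((\<lambda>x. f (g x)) ` D) = f (g x)"
    by (rule imageE)
  have x: "x \<in> D" "\<And>y. y \<in> D \<Longrightarrow> f (g y) \<le> f (g x)"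
    using \<open>x \<in> D\<close> D(2) by (auto simp flip: eq)
  then have "g x \<in> K" using D g by auto
  then obtain y where "y \<in> D" "g x \<in> S y" using D by auto
  then have "f (g x) < f (g y)" using S(3) D \<open>g x \<in> K\<close> by blast
  with x(2)[OF \<open>y \<in> D\<close>] show False by simp
qed

lemma closed_usc_superlevel:
  assumes "closed K" "usc_on K f"
  shows "closed {x \<in> K. c \<le> f x}"
  unfolding closed_def
proof (subst open_subopen, rule ballI)
  fix x assume x: "x \<in> - {x \<in> K. c \<le> f x}"
  show "\<exists>T. open T \<and> x \<in> T \<and> T \<subseteq> - {x \<in> K. c \<le> f x}"
  proof (cases "x \<in> K")
    case True
    then have "\<forall>\<^sub>F y in nhds_within x K. f y < c"
      using assms(2) x by (simp add: usc_on_iff)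
    then obtain S where "open S" "x \<in> S" "\<forall>y\<in>S. y \<in> K \<longrightarrow> f y < c"
      unfolding eventually_nhds_within by blast
    then show ?thesis by (intro exI[of _ S]) force
  next
    case False
    then show ?thesis using assms(1) by (intro exI[of _ "- K"]) (auto simp: closed_def)
  qed
qed

section \<open>Quasi-periodic functions and the doubled maximum\<close>

lemma shift_of_int:
  fixes f :: "real \<Rightarrow> real"
  assumes "\<And>x. f (x + c) = f x + d"
  shows "f (x + of_int k * c) = f x + of_int k * d"
proof (induction k rule: int_induct[where k = 0])
  case (step1 i)
  then show ?case using assms[of "x + of_int i * c"] by (simp add: algebra_simps)
next
  case (step2 i)
  then show ?case using assms[of "x + of_int (i - 1) * c"] by (simp add: algebra_simps)
qed simp

lemma ex_shift_into_period:
  fixes x c :: real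
  assumes "c > 0"
  shows "\<exists>k::int. x + of_int k * c \<in> {0..<c}"
proof -
  have "of_int \<lfloor>x / c\<rfloor> * c \<le> x / c * c" "x / c * c < (of_int \<lfloor>x / c\<rfloor> + 1) * c"
    using assms by (intro mult_right_mono mult_strict_right_mono; linarith)+
  then show ?thesis
    using assms by (intro exI[of _ "- \<lfloor>x / c\<rfloor>"]) (simp add: distrib_right)
qed

text \<open>The linear bounds confine the relevant pairs, modulo a common translation, to a compact
  set that is the same for all \<open>\<alpha> \<ge> 1\<close>. Pairs of value at least
  \<open>\<sigma>\<close> with a vanishing time cannot be diagonal by \<open>init\<close>, hence by
  compactness are a fixed distance apart, and a large \<open>\<alpha>\<close> rules them out as
  maximisers.\<close>

lemma doubling_maximum:
  fixes U V :: "real \<times> real \<Rightarrow> real"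
  assumes U: "usc_on half_space U" and V: "lsc_on half_space V"
    and Ushift: "\<And>t x. t \<ge> 0 \<Longrightarrow> U (t, x + 2 * pi) = U (t, x) + 1"
    and Vshift: "\<And>t x. t \<ge> 0 \<Longrightarrow> V (t, x + 2 * pi) = V (t, x) + 1"
    and Ubound: "\<And>t x. t \<ge> 0 \<Longrightarrow> U (t, x) \<le> x / (2 * pi) + C - t"
    and Vbound: "\<And>t x. t \<ge> 0 \<Longrightarrow> x / (2 * pi) - C + t \<le> V (t, x)"
    and init: "\<And>x. U (0, x) \<le> V (0, x)"
    and t1: "t1 \<ge> 0" "V (t1, x1) < U (t1, x1)"
  shows "\<exists>\<alpha>>0. \<exists>p\<in>half_space. \<exists>q\<in>half_space. fst p > 0 \<and> fst q > 0 \<and>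
    (\<forall>p'\<in>half_space. \<forall>q'\<in>half_space.
       U p' - V q' - \<alpha> / 2 * (norm (p' - q'))\<^sup>2 \<le> U p - V q - \<alpha> / 2 * (norm (p - q))\<^sup>2)"
proof -
  define \<sigma> where "\<sigma> = U (t1, x1) - V (t1, x1)"
  \<comment> \<open>\<open>2 * C\<close> comes from the two linear bounds; the 1 comes from
    \<open>N \<le> 1 + N\<^sup>2 / 4\<close>, which absorbs the difference of the linear parts into
    half of the quadratic penalty.\<close>
  define R where "R = 2 * C + 1"
  define W where "W \<alpha> z = U (fst z) - V (snd z) - \<alpha> / 2 * (norm (fst z - snd z))\<^sup>2" for \<alpha> z
  define K where "K = ({0..R} \<times> {0..2 * pi}) \<times> ({0..R} \<times> {- 2 * R..2 * pi + 2 * R})"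
  have "\<sigma> > 0" using t1 by (simp add: \<sigma>_def)
  then have "R \<ge> 1"
    using Ubound[OF t1(1), of x1] Vbound[OF t1(1), of x1] t1 by (simp add: R_def)
  have "pi > 1" using pi_gt3 by simp
  have bound: "W \<alpha> ((t, x), (s, y)) \<le> R - t - s - \<alpha> / 4 * (norm ((t, x) - (s, y)))\<^sup>2"
    if "t \<ge> 0" "s \<ge> 0" "\<alpha> \<ge> 1" for \<alpha> t x s y
  proof -
    define N where "N = norm ((t, x) - (s, y))"
    have "\<bar>x - y\<bar> \<le> N" unfolding N_def by (simp add: norm_Pair real_le_rsqrt)
    have "(x - y) / (2 * pi) \<le> \<bar>x - y\<bar> / (2 * pi)" by (simp add: divide_right_mono)
    also have "\<dots> \<le> \<bar>x - y\<bar>" using \<open>pi > 1\<close> by (simp add: divide_le_eq mult_le_cancel_left1)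
    also have "\<dots> \<le> N" by fact
    also have "N \<le> 1 + N\<^sup>2 / 4"
      using zero_le_power2[of "N / 2 - 1"] by (simp add: power2_eq_square field_simps)
    also have "N\<^sup>2 / 4 \<le> \<alpha> / 4 * N\<^sup>2"
      using mult_right_mono[OF \<open>\<alpha> \<ge> 1\<close>, of "N\<^sup>2"] by simp
    finally have "x / (2 * pi) - y / (2 * pi) \<le> 1 + \<alpha> / 4 * N\<^sup>2"
      by (simp add: diff_divide_distrib)
    moreover have "W \<alpha> ((t, x), (s, y)) = U (t, x) - V (s, y) - \<alpha> / 2 * N\<^sup>2"
      by (simp add: W_def N_def)
    ultimately show ?thesis
      using Ubound[OF that(1), of x] Vbound[OF that(2), of y]
      unfolding R_def N_def[symmetric] by linarith
  qed
  have inK: "((t, x), (s, y)) \<in> K"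
    if "t \<ge> 0" "s \<ge> 0" "\<alpha> \<ge> 1" "0 \<le> W \<alpha> ((t, x), (s, y))" "x \<in> {0..2 * pi}" for \<alpha> t x s y
  proof -
    define N where "N = norm ((t, x) - (s, y))"
    have le: "t + s + \<alpha> / 4 * N\<^sup>2 \<le> R" using bound[OF that(1-3), of x y] that(4) by (simp add: N_def)
    moreover have "0 \<le> \<alpha> / 4 * N\<^sup>2" using \<open>\<alpha> \<ge> 1\<close> by simp
    moreover have "N\<^sup>2 / 4 \<le> \<alpha> / 4 * N\<^sup>2"
      using mult_right_mono[OF \<open>\<alpha> \<ge> 1\<close>, of "N\<^sup>2"] by simp
    ultimately have "t \<le> R" "s \<le> R" "N\<^sup>2 \<le> 4 * R" using that(1,2) by linarith+
    note this(3)
    also have "4 * R \<le> (2 * R)\<^sup>2"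
      using \<open>R \<ge> 1\<close> mult_left_mono[of 1 R "4 * R"] by (simp add: power2_eq_square)
    finally have "N \<le> 2 * R" by (rule power2_le_imp_le) (use \<open>R \<ge> 1\<close> in auto)
    moreover have "\<bar>x - y\<bar> \<le> N" unfolding N_def by (simp add: norm_Pair real_le_rsqrt)
    ultimately have "\<bar>x - y\<bar> \<le> 2 * R" by simp
    then show ?thesis using that \<open>t \<le> R\<close> \<open>s \<le> R\<close> by (auto simp: K_def)
  qed
  \<comment> \<open>Only a simultaneous translation of both points leaves \<open>W\<close>
    unchanged. It puts \<open>x\<close> into one period, and the quadratic penalty then controls
    \<open>y\<close>; hence the asymmetric shape of \<open>K\<close>.\<close>
  have shiftW: "W \<alpha> ((t, x + of_int k * (2 * pi)), (s, y + of_int k * (2 * pi))) = W \<alpha> ((t, x), (s, y))"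
    if "t \<ge> 0" "s \<ge> 0" for \<alpha> t x s y and k :: int
    using shift_of_int[of "\<lambda>x. U (t, x)" "2 * pi" 1 x k] shift_of_int[of "\<lambda>x. V (s, x)" "2 * pi" 1 y k]
      Ushift[OF that(1)] Vshift[OF that(2)]
    by (simp add: W_def)
  have "compact K" unfolding K_def by (intro compact_Times) auto
  have sub: "K \<subseteq> half_space \<times> half_space" by (auto simp: K_def half_space_def)
  have uscW: "usc_on K (W \<alpha>)" for \<alpha>
  proof -
    have "usc_on K (\<lambda>z. U (fst z))"
      using sub by (intro usc_on_compose[OF U] continuous_intros) auto
    moreover have "usc_on K (\<lambda>z. - V (snd z))"
      using sub by (intro usc_on_compose[OF V[unfolded lsc_on_iff_usc_on]] continuous_intros) auto
    moreover have "usc_on K (\<lambda>z. - (\<alpha> / 2 * (norm (fst z - snd z))\<^sup>2))"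
      by (intro continuous_imp_usc_on continuous_intros)
    ultimately have "usc_on K (\<lambda>z. (U (fst z) + (- V (snd z))) + (- (\<alpha> / 2 * (norm (fst z - snd z))\<^sup>2)))"
      by (intro usc_on_add)
    then show ?thesis by (simp add: W_def[abs_def])
  qed
  \<comment> \<open>Defined with \<open>W 0\<close>, so that \<open>S\<close> and the distance
    \<open>\<delta>\<close> below are fixed before \<open>\<alpha>\<close> is chosen.\<close>
  define S where "S = {z \<in> K. \<sigma> \<le> W 0 z} \<inter> ({z. fst (fst z) = 0} \<union> {z. fst (snd z) = 0})"
  have "compact S"
  proof (rule compact_Int_closed[of K, THEN back_subst[of compact]])
    show "closed S" unfolding S_def
      by (intro closed_Int closed_Un closed_usc_superlevel compact_imp_closed \<open>compact K\<close> uscW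
          closed_Collect_eq continuous_intros)
    show "K \<inter> S = S" by (auto simp: S_def)
  qed (fact \<open>compact K\<close>)
  have offdiag: "norm (fst z - snd z) > 0" if "z \<in> S" for z
  proof -
    have "fst z \<noteq> snd z"
    proof
      assume eq: "fst z = snd z"
      obtain t x where "fst z = (t, x)" by (cases "fst z")
      with eq have z: "z = ((t, x), (t, x))" by (simp add: prod_eq_iff)
      then have "t = 0" using that by (simp add: S_def)
      then show False using that init[of x] \<open>\<sigma> > 0\<close> by (simp add: S_def W_def z)
    qed
    then show ?thesis by simp
  qed
  obtain \<delta> where "\<delta> > 0" and \<delta>: "\<And>z. z \<in> S \<Longrightarrow> \<delta> \<le> norm (fst z - snd z)"
  proof (cases "S = {}")
    case False
    have "continuous_on S (\<lambda>z. norm (fst z - snd z))" by (intro continuous_intros)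
    from continuous_attains_inf[OF \<open>compact S\<close> False this]
    obtain z where "z \<in> S" "\<forall>w\<in>S. norm (fst z - snd z) \<le> norm (fst w - snd w)" by blast
    then show ?thesis using offdiag that by blast
  qed (use that[of 1] in auto)
  \<comment> \<open>A maximiser in \<open>S\<close> would have penalty
    \<open>\<alpha> / 4 * \<delta>\<^sup>2 \<le> R\<close>, but here this quantity is
    \<open>R + \<delta>\<^sup>2 / 4\<close>.\<close>
  define \<alpha> where "\<alpha> = 4 * R / \<delta>\<^sup>2 + 1"
  have "\<alpha> \<ge> 1" using \<open>R \<ge> 1\<close> by (simp add: \<alpha>_def)
  obtain k1 :: int where k1: "x1 + of_int k1 * (2 * pi) \<in> {0..<2 * pi}"
    using ex_shift_into_period[of "2 * pi" x1] by auto
  define p1 where "p1 = (t1, x1 + of_int k1 * (2 * pi))"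
  have Wp1: "W \<alpha> (p1, p1) = \<sigma>"
    using shiftW[OF t1(1) t1(1), of \<alpha> x1 k1 x1] by (simp add: p1_def W_def \<sigma>_def)
  then have p1K: "(p1, p1) \<in> K"
    using inK[OF t1(1) t1(1) \<open>\<alpha> \<ge> 1\<close>] k1 \<open>\<sigma> > 0\<close> unfolding p1_def by auto
  then obtain z where z: "z \<in> K" "\<And>w. w \<in> K \<Longrightarrow> W \<alpha> w \<le> W \<alpha> z"
    using usc_on_attains_sup[OF \<open>compact K\<close> _ uscW[of \<alpha>]] by blast
  have Wz: "\<sigma> \<le> W \<alpha> z" using z(2)[OF p1K] Wp1 by simp
  obtain t x s y where zeq: "z = ((t, x), (s, y))" by (metis surj_pair)
  have "t \<ge> 0" "s \<ge> 0" using z(1) by (auto simp: K_def zeq)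
  have "z \<notin> S"
  proof
    assume "z \<in> S"
    have "\<alpha> / 4 * (norm (fst z - snd z))\<^sup>2 \<le> R"
      using bound[OF \<open>t \<ge> 0\<close> \<open>s \<ge> 0\<close> \<open>\<alpha> \<ge> 1\<close>, of x y] Wz \<open>\<sigma> > 0\<close> \<open>t \<ge> 0\<close> \<open>s \<ge> 0\<close>
      by (simp add: zeq)
    moreover have "\<alpha> / 4 * \<delta>\<^sup>2 \<le> \<alpha> / 4 * (norm (fst z - snd z))\<^sup>2"
      using \<delta>[OF \<open>z \<in> S\<close>] \<open>\<delta> > 0\<close> \<open>\<alpha> \<ge> 1\<close> by (intro mult_left_mono power_mono) auto
    moreover have "\<alpha> / 4 * \<delta>\<^sup>2 = R + \<delta>\<^sup>2 / 4"
      using \<open>\<delta> > 0\<close> by (simp add: \<alpha>_def field_simps)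
    ultimately have "\<delta>\<^sup>2 \<le> 0" by linarith
    then show False using \<open>\<delta> > 0\<close> by simp
  qed
  moreover have "W \<alpha> z \<le> W 0 z" using \<open>\<alpha> \<ge> 1\<close> by (simp add: W_def)
  ultimately have "t \<noteq> 0" "s \<noteq> 0" using z(1) Wz by (auto simp: S_def zeq)
  have max: "W \<alpha> (p', q') \<le> W \<alpha> z" if "p' \<in> half_space" "q' \<in> half_space" for p' q'
  proof (cases "0 \<le> W \<alpha> (p', q')")
    case True
    obtain t' x' s' y' where eq: "p' = (t', x')" "q' = (s', y')" by (metis surj_pair)
    have nn: "t' \<ge> 0" "s' \<ge> 0" using that by (auto simp: eq half_space_def)
    obtain k :: int where k: "x' + of_int k * (2 * pi) \<in> {0..<2 * pi}"
      using ex_shift_into_period[of "2 * pi" x'] by auto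
    have "((t', x' + of_int k * (2 * pi)), (s', y' + of_int k * (2 * pi))) \<in> K"
      using True k shiftW[OF nn, of \<alpha> x' k y'] by (intro inK[OF nn \<open>\<alpha> \<ge> 1\<close>]) (auto simp: eq)
    from z(2)[OF this] show ?thesis using shiftW[OF nn, of \<alpha> x' k y'] by (simp add: eq)
  next
    case False
    then show ?thesis using Wz \<open>\<sigma> > 0\<close> by simp
  qed
  have "fst z \<in> half_space" "snd z \<in> half_space" using z(1) sub by (auto simp: zeq)
  moreover have "0 < fst (fst z)" "0 < fst (snd z)"
    using \<open>t \<noteq> 0\<close> \<open>s \<noteq> 0\<close> \<open>t \<ge> 0\<close> \<open>s \<ge> 0\<close> by (simp_all add: zeq)
  moreover have "U p' - V q' - \<alpha> / 2 * (norm (p' - q'))\<^sup>2 \<le>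
      U (fst z) - V (snd z) - \<alpha> / 2 * (norm (fst z - snd z))\<^sup>2"
    if "p' \<in> half_space" "q' \<in> half_space" for p' q'
    using max[OF that] by (simp add: W_def)
  moreover have "0 < \<alpha>" using \<open>\<alpha> \<ge> 1\<close> by simp
  ultimately show ?thesis by blast
qed

lemma has_real_derivative_max_0_squared:
  "((\<lambda>t. (max 0 (t - a))\<^sup>2) has_real_derivative 2 * max 0 (t - a)) (at t)"
proof -
  consider "t < a" | "t = a" | "t > a" by linarith
  then show ?thesis
  proof cases
    case 1
    have "((\<lambda>_. 0) has_real_derivative 0) (at t)" by simp
    then have "((\<lambda>t. (max 0 (t - a))\<^sup>2) has_real_derivative 0) (at t)"
      by (rule has_field_derivative_transform_within_open[of _ _ _ "{..<a}"]) (use 1 in auto)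
    then show ?thesis using 1 by simp
  next
    case 2
    have "(\<lambda>h. ((max 0 (a + h - a))\<^sup>2 - (max 0 (a - a))\<^sup>2) / h) \<midarrow>0\<rightarrow> 0"
    proof (rule Lim_null_comparison)
      show "\<forall>\<^sub>F h in at 0. norm (((max 0 (a + h - a))\<^sup>2 - (max 0 (a - a))\<^sup>2) / h) \<le> \<bar>h\<bar>"
        by (rule always_eventually) (auto simp: max_def power2_eq_square)
      show "((\<lambda>h::real. \<bar>h\<bar>) \<longlongrightarrow> 0) (at 0)" by (rule tendsto_eq_intros | simp)+
    qed
    then show ?thesis using 2 by (simp add: DERIV_def)
  next
    case 3
    have "((\<lambda>t. (t - a)\<^sup>2) has_real_derivative 2 * (t - a)) (at t)"
      by (auto intro!: derivative_eq_intros)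
    then have "((\<lambda>t. (max 0 (t - a))\<^sup>2) has_real_derivative 2 * (t - a)) (at t)"
      by (rule has_field_derivative_transform_within_open[of _ _ _ "{a<..}"]) (use 3 in auto)
    then show ?thesis using 3 by simp
  qed
qed

text \<open>A locally finite sum of squared positive parts: the term for \<open>n\<close> is zero up
  to \<open>T + n\<close> and at least \<open>\<bar>b n\<bar>\<close> from \<open>T + n + 1\<close>
  on. Continuous differentiability and \<open>0 \<le> G' t\<close> are demanded because
  \<open>G\<close> becomes part of the test functions, with its derivative on the favourable
  side.\<close>

lemma ex_C1_majorant:
  fixes b :: "nat \<Rightarrow> real" and T :: real
  shows "\<exists>G G'. (\<forall>t. (G has_real_derivative G' t) (at t)) \<and> continuous_on UNIV G' \<and>
    (\<forall>t. 0 \<le> G' t) \<and> (\<forall>t. 0 \<le> G t) \<and> (\<forall>t\<le>T. G t = 0) \<and> (\<forall>n. \<forall>t\<ge>T + real n + 1. b n \<le> G t)"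
proof -
  define G where "G t = (\<Sum>n<nat \<lceil>t - T\<rceil>. \<bar>b n\<bar> * (max 0 (t - (T + real n)))\<^sup>2)" for t
  define G' where "G' t = (\<Sum>n<nat \<lceil>t - T\<rceil>. \<bar>b n\<bar> * (2 * max 0 (t - (T + real n))))" for t
  \<comment> \<open>The number of summands depends on \<open>t\<close>; adding vanishing terms makes
    it constant near a given \<open>t\<close>, so the sum can be differentiated termwise.\<close>
  have G: "G t = (\<Sum>n<N. \<bar>b n\<bar> * (max 0 (t - (T + real n)))\<^sup>2)" if "t \<le> T + real N" for t N
    unfolding G_def using that by (intro sum.mono_neutral_left) (auto simp: nat_le_iff ceiling_le_iff)
  have G': "G' t = (\<Sum>n<N. \<bar>b n\<bar> * (2 * max 0 (t - (T + real n))))" if "t \<le> T + real N" for t N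
    unfolding G'_def using that by (intro sum.mono_neutral_left) (auto simp: nat_le_iff ceiling_le_iff)
  have ex: "\<exists>N. t < T + real N" for t
    using reals_Archimedean2[of "t - T"] by (auto simp: algebra_simps)
  have "(G has_real_derivative G' t) (at t)" for t
  proof -
    obtain N where N: "t < T + real N" using ex by blast
    have "((\<lambda>t. \<Sum>n<N. \<bar>b n\<bar> * (max 0 (t - (T + real n)))\<^sup>2) has_real_derivative
        (\<Sum>n<N. \<bar>b n\<bar> * (2 * max 0 (t - (T + real n))))) (at t)"
      by (intro DERIV_sum DERIV_cmult has_real_derivative_max_0_squared)
    then have "(G has_real_derivative (\<Sum>n<N. \<bar>b n\<bar> * (2 * max 0 (t - (T + real n))))) (at t)"
      by (rule has_field_derivative_transform_within_open[of _ _ _ "{..<T + real N}"])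
        (auto simp: N G[of _ N])
    then show ?thesis using G'[of t N] N by simp
  qed
  moreover have "continuous_on UNIV G'"
  proof (rule continuous_at_imp_continuous_on, rule ballI)
    fix t
    obtain N where N: "t < T + real N" using ex by blast
    have "continuous_on {..<T + real N} (\<lambda>t. \<Sum>n<N. \<bar>b n\<bar> * (2 * max 0 (t - (T + real n))))"
      by (intro continuous_intros)
    then have "continuous_on {..<T + real N} G'"
      by (rule continuous_on_eq) (auto simp: G'[of _ N])
    then show "isCont G' t" using N by (simp add: continuous_on_eq_continuous_at)
  qed
  moreover have "0 \<le> G' t" "0 \<le> G t" for t
    by (auto simp: G_def G'_def intro!: sum_nonneg)
  moreover have "G t = 0" if "t \<le> T" for t using that by (simp add: G_def)
  moreover have "b n \<le> G t" if t: "t \<ge> T + real n + 1" for n t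
  proof -
    have "1 \<le> (max 0 (t - (T + real n)))\<^sup>2"
      using t by (intro one_le_power) auto
    then have "\<bar>b n\<bar> * 1 \<le> \<bar>b n\<bar> * (max 0 (t - (T + real n)))\<^sup>2"
      by (intro mult_left_mono) auto
    then have "b n \<le> \<bar>b n\<bar> * (max 0 (t - (T + real n)))\<^sup>2" by linarith
    also have "\<dots> \<le> G t"
      unfolding G_def using t by (intro member_le_sum) (auto simp: zless_nat_eq_int_zless less_ceiling_iff)
    finally show ?thesis .
  qed
  ultimately show ?thesis by blast
qed


section \<open>The comparison principle\<close>

lemma arctan_diff_le:
  assumes "x \<le> y"
  shows "arctan y - arctan x \<le> y - x"
proof -
  have "(\<lambda>x. x - arctan x) x \<le> (\<lambda>x. x - arctan x) y"
  proof (rule DERIV_nonneg_imp_nondecreasing[OF assms], intro exI conjI)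
    fix u :: real
    show "((\<lambda>x. x - arctan x) has_real_derivative (1 - inverse (1 + u\<^sup>2))) (at u)"
      by (auto intro!: derivative_eq_intros)
    have "1 \<le> 1 + u\<^sup>2" by simp
    then show "0 \<le> 1 - inverse (1 + u\<^sup>2)" by (simp add: inverse_le_1_iff)
  qed
  then show ?thesis by simp
qed

text \<open>Subtracting the linear part leaves a periodic function, so a maximum over one period and
  a compact time interval suffices; \<open>\<bar>s\<bar>\<close> pays for the linear part within a
  period. The sign of \<open>s\<close> is left open because \<open>- V\<close> has jump
  \<open>- 1\<close>.\<close>

lemma usc_periodic_bounded_above:
  assumes U: "usc_on half_space U"
    and shift: "\<And>t x. t \<ge> 0 \<Longrightarrow> U (t, x + 2 * pi) = U (t, x) + s"
  shows "\<exists>B. \<forall>t\<in>{0..T}. \<forall>x. U (t, x) \<le> s * x / (2 * pi) + B"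
proof (cases "T \<ge> 0")
  case True
  define K where "K = {0..T} \<times> {0..2 * pi}"
  have "compact K" unfolding K_def by (intro compact_Times compact_Icc)
  moreover have "K \<noteq> {}" using True by (simp add: K_def)
  moreover have "usc_on K U" by (rule usc_on_subset[OF U]) (auto simp: K_def half_space_def)
  ultimately have "\<exists>p\<in>K. \<forall>q\<in>K. U q \<le> U p" by (rule usc_on_attains_sup)
  then obtain p where p: "\<And>q. q \<in> K \<Longrightarrow> U q \<le> U p" by blast
  have "U (t, x) \<le> s * x / (2 * pi) + (U p + \<bar>s\<bar>)" if t: "t \<in> {0..T}" for t x
  proof -
    obtain k :: int where k: "x + of_int k * (2 * pi) \<in> {0..<2 * pi}"
      using ex_shift_into_period[of "2 * pi" x] by auto
    have "U (t, x) = U (t, x + of_int k * (2 * pi)) - of_int k * s"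
      using shift_of_int[of "\<lambda>x. U (t, x)" "2 * pi" s x k] shift t by simp
    moreover have "U (t, x + of_int k * (2 * pi)) \<le> U p"
      using p[of "(t, x + of_int k * (2 * pi))"] k t by (auto simp: K_def)
    moreover have "- of_int k * s \<le> s * x / (2 * pi) + \<bar>s\<bar>"
    proof -
      define y where "y = (x + of_int k * (2 * pi)) / (2 * pi)"
      have "0 \<le> y" "y \<le> 1" using k by (simp_all add: y_def divide_le_eq)
      then have "\<bar>s\<bar> * y \<le> \<bar>s\<bar>" by (intro mult_left_le) auto
      then have "- \<bar>s\<bar> \<le> s * y"
        using abs_ge_minus_self[of "s * y"] \<open>0 \<le> y\<close> by (simp add: abs_mult)
      moreover have "s * x / (2 * pi) = s * y - of_int k * s"
        by (simp add: y_def field_simps)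
      ultimately show ?thesis by linarith
    qed
    ultimately show ?thesis by linarith
  qed
  then show ?thesis by blast
qed auto

theorem comparison_principle:
  assumes U: "viscosity_subsolution U" and V: "viscosity_supersolution V"
    and grow: "space_growth m U" "m > 0"
    and Ushift: "\<And>t x. t \<ge> 0 \<Longrightarrow> U (t, x + 2 * pi) = U (t, x) + 1"
    and Vshift: "\<And>t x. t \<ge> 0 \<Longrightarrow> V (t, x + 2 * pi) = V (t, x) + 1"
    and init: "\<And>x. U (0, x) \<le> V (0, x) + e"
    and "t \<ge> 0"
  shows "U (t, x) \<le> V (t, x) + e"
proof (rule ccontr)
  assume "\<not> U (t, x) \<le> V (t, x) + e"
  define \<sigma> where "\<sigma> = U (t, x) - V (t, x) - e"
  have "\<sigma> > 0" using \<open>\<not> U (t, x) \<le> V (t, x) + e\<close> by (simp add: \<sigma>_def)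
  have uscU: "usc_on half_space U" and lscV: "lsc_on half_space V"
    using U V by (auto simp: viscosity_subsolution_def viscosity_supersolution_def)
  have "\<exists>B. \<forall>s\<in>{0..T}. \<forall>y. U (s, y) \<le> y / (2 * pi) + B \<and> y / (2 * pi) - B \<le> V (s, y)" for T
  proof -
    obtain B1 where B1: "\<forall>s\<in>{0..T}. \<forall>y. U (s, y) \<le> 1 * y / (2 * pi) + B1"
      using usc_periodic_bounded_above[OF uscU Ushift] by blast
    obtain B2 where B2: "\<forall>s\<in>{0..T}. \<forall>y. - V (s, y) \<le> - 1 * y / (2 * pi) + B2"
      using usc_periodic_bounded_above[OF lscV[unfolded lsc_on_iff_usc_on], of "- 1" T] Vshift by auto
    have "U (s, y) \<le> y / (2 * pi) + max B1 B2 \<and> y / (2 * pi) - max B1 B2 \<le> V (s, y)"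
      if "s \<in> {0..T}" for s y
      using bspec[OF B1 that, THEN spec, of y] bspec[OF B2 that, THEN spec, of y]
      by (auto simp: max_def)
    then show ?thesis by blast
  qed
  then obtain B where B: "\<And>T s y. s \<in> {0..T} \<Longrightarrow> U (s, y) \<le> y / (2 * pi) + B T"
    "\<And>T s y. s \<in> {0..T} \<Longrightarrow> y / (2 * pi) - B T \<le> V (s, y)"
    by metis
  \<comment> \<open>\<open>U\<close> and \<open>V\<close> are only locally bounded in time; the penalty must beat their growth as \<open>t \<rightarrow> \<infinity>\<close>.\<close>
  define b where "b n = \<bar>B (t + real n + 2)\<bar> + \<bar>e\<bar> + (t + real n + 2)" for n
  obtain G G' where G: "\<And>s. (G has_real_derivative G' s) (at s)" "continuous_on UNIV G'"
    "\<And>s. 0 \<le> G' s" "\<And>s. 0 \<le> G s" "\<And>s. s \<le> t \<Longrightarrow> G s = 0"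
    "\<And>n s. t + real n + 1 \<le> s \<Longrightarrow> b n \<le> G s"
    using ex_C1_majorant[of t b] by auto
  \<comment> \<open>Small enough that the total penalty \<open>2 * \<eta> * t\<close> at the
    offending point stays below \<open>\<sigma>\<close>; \<open>G\<close> vanishes there.\<close>
  define \<eta> where "\<eta> = \<sigma> / (4 * (t + 1))"
  have "\<eta> > 0" using \<open>\<sigma> > 0\<close> \<open>t \<ge> 0\<close> by (simp add: \<eta>_def)
  define H where "H s = G s + \<eta> * s" for s
  define H' where "H' s = G' s + \<eta>" for s
  have H: "(H has_real_derivative H' s) (at s)" for s
    unfolding H_def[abs_def] H'_def using G(1) by (auto intro!: derivative_eq_intros)
  have H'cont: "continuous_on UNIV H'"
    unfolding H'_def[abs_def] using G(2) by (intro continuous_intros)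
  have H'ge: "\<eta> \<le> H' s" for s using G(3) by (simp add: H'_def)
  define C where "C = \<bar>B (t + 1)\<bar> + \<bar>e\<bar> + (t + 1)"
  have growH: "\<bar>B'\<bar> + \<bar>e\<bar> \<le> C - s + H s"
    if "s \<ge> 0" "s \<le> t + 1 \<and> B' = B (t + 1) \<or> t + real n + 1 \<le> s \<and> s \<le> t + real n + 2 \<and> B' = B (t + real n + 2)"
    for s B' n
  proof -
    have "0 \<le> \<eta> * s" using \<open>\<eta> > 0\<close> that by simp
    from that(2) show ?thesis
    proof
      assume "s \<le> t + 1 \<and> B' = B (t + 1)"
      then show ?thesis using G(4)[of s] \<open>0 \<le> \<eta> * s\<close> by (simp add: H_def C_def)
    next
      assume *: "t + real n + 1 \<le> s \<and> s \<le> t + real n + 2 \<and> B' = B (t + real n + 2)"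
      have "0 \<le> C" using \<open>t \<ge> 0\<close> by (simp add: C_def)
      then show ?thesis using G(6)[of n s] * \<open>0 \<le> \<eta> * s\<close> by (simp add: H_def b_def)
    qed
  qed
  \<comment> \<open>Time is cut into \<open>{0..t + 1}\<close>, handled by \<open>C\<close>, and
    unit intervals beyond it, on each of which \<open>G\<close> dominates the bound \<open>B\<close>
    taken at the right end.\<close>
  have slice: "\<exists>T. s \<in> {0..T} \<and> \<bar>B T\<bar> + \<bar>e\<bar> \<le> C - s + H s" if "s \<ge> 0" for s
  proof (cases "s \<le> t + 1")
    case True
    then show ?thesis using growH[OF that] that by (intro exI[of _ "t + 1"]) auto
  next
    case False
    define n where "n = nat \<lfloor>s - t - 1\<rfloor>"
    have "t + real n + 1 \<le> s" "s \<le> t + real n + 2" using False unfolding n_def by linarith+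
    then show ?thesis using growH[OF that, of "B (t + real n + 2)" n] that
      by (intro exI[of _ "t + real n + 2"]) auto
  qed
  \<comment> \<open>The penalty is split between both functions: the test functions carry
    \<open>H\<close> for \<open>U\<close> and \<open>- H\<close> for \<open>V\<close>, so both
    derivatives of \<open>H\<close> help in the final contradiction.\<close>
  define U1 where "U1 p = U p - e - H (fst p)" for p
  define V1 where "V1 p = V p + H (fst p)" for p
  have contH: "continuous_on half_space (\<lambda>p. - e - H (fst p))" "continuous_on half_space (\<lambda>p. - H (fst p))"
    using DERIV_continuous_on[OF has_field_derivative_at_within[OF H], of UNIV]
    by (auto intro!: continuous_intros intro: continuous_on_compose2[of UNIV H])
  have "\<exists>\<alpha>>0. \<exists>p\<in>half_space. \<exists>q\<in>half_space. fst p > 0 \<and> fst q > 0 \<and>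
    (\<forall>p'\<in>half_space. \<forall>q'\<in>half_space.
       U1 p' - V1 q' - \<alpha> / 2 * (norm (p' - q'))\<^sup>2 \<le> U1 p - V1 q - \<alpha> / 2 * (norm (p - q))\<^sup>2)"
  proof (rule doubling_maximum)
    show "usc_on half_space U1"
      using usc_on_add[OF uscU continuous_imp_usc_on[OF contH(1)]]
      by (simp add: U1_def[abs_def] algebra_simps)
    show "lsc_on half_space V1"
      using usc_on_add[OF lscV[unfolded lsc_on_iff_usc_on] continuous_imp_usc_on[OF contH(2)]]
      by (simp add: V1_def[abs_def] lsc_on_iff_usc_on)
    show "U1 (s, y + 2 * pi) = U1 (s, y) + 1" "V1 (s, y + 2 * pi) = V1 (s, y) + 1" if "s \<ge> 0" for s y
      using Ushift[OF that] Vshift[OF that] by (simp_all add: U1_def V1_def)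
    show "U1 (s, y) \<le> y / (2 * pi) + C - s" "y / (2 * pi) - C + s \<le> V1 (s, y)" if "s \<ge> 0" for s y
    proof -
      obtain T where T: "s \<in> {0..T}" "\<bar>B T\<bar> + \<bar>e\<bar> \<le> C - s + H s" using slice[OF \<open>s \<ge> 0\<close>] by blast
      show "U1 (s, y) \<le> y / (2 * pi) + C - s" "y / (2 * pi) - C + s \<le> V1 (s, y)"
        using B[OF T(1), of y] T(2) by (simp_all add: U1_def V1_def)
    qed
    show "U1 (0, y) \<le> V1 (0, y)" for y
      using init[of y] G(5)[of 0] \<open>t \<ge> 0\<close> by (simp add: U1_def V1_def H_def)
    show "t \<ge> 0" by fact
    have "2 * \<eta> * t < \<sigma>"
      using \<open>\<sigma> > 0\<close> \<open>t \<ge> 0\<close> by (simp add: \<eta>_def field_simps add_pos_nonneg)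
    then show "V1 (t, x) < U1 (t, x)"
      using G(5)[of t] by (simp add: U1_def V1_def H_def \<sigma>_def)
  qed
  then obtain \<alpha> p q where "\<alpha> > 0" and pq: "p \<in> half_space" "q \<in> half_space" "fst p > 0" "fst q > 0"
    and max: "\<And>p' q'. p' \<in> half_space \<Longrightarrow> q' \<in> half_space \<Longrightarrow>
       U1 p' - V1 q' - \<alpha> / 2 * (norm (p' - q'))\<^sup>2 \<le> U1 p - V1 q - \<alpha> / 2 * (norm (p - q))\<^sup>2"
    by blast
  define M where "M = U1 p - V1 q - \<alpha> / 2 * (norm (p - q))\<^sup>2"
  have "\<exists>\<phi> \<xi> L. (\<forall>x. (\<phi> has_derivative (\<lambda>v. \<xi> x \<bullet> v)) (at x)) \<and> L-lipschitz_on UNIV \<xi> \<and>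
     (\<forall>z. \<phi> (z + (0, 2 * pi)) = \<phi> z + 1) \<and>
     (\<forall>p\<in>half_space. \<forall>z. U1 p \<le> \<phi> z + \<alpha> * (norm (p - z))\<^sup>2) \<and>
     (\<forall>q\<in>half_space. \<forall>z. \<phi> z \<le> V1 q + M + \<alpha> * (norm (q - z))\<^sup>2)"
  proof (rule C11_between)
    show "half_space \<noteq> {}" "0 \<le> \<alpha>" using pq \<open>\<alpha> > 0\<close> by auto
    show "U1 p' - V1 q' \<le> M + \<alpha> / 2 * (norm (p' - q'))\<^sup>2" if "p' \<in> half_space" "q' \<in> half_space" for p' q'
      using max[OF that] by (simp add: M_def)
    show "p' + (0, 2 * pi) \<in> half_space \<longleftrightarrow> p' \<in> half_space" for p'
      by (cases p') (auto simp: half_space_def)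
    show "V1 (p' + (0, 2 * pi)) = V1 p' + 1" if "p' \<in> half_space" for p'
      using that Vshift by (cases p') (auto simp: half_space_def V1_def)
  qed
  then obtain \<phi> \<xi> L where D: "\<And>x. (\<phi> has_derivative (\<lambda>v. \<xi> x \<bullet> v)) (at x)"
    and Lip: "L-lipschitz_on UNIV \<xi>" and shift: "\<And>z. \<phi> (z + (0, 2 * pi)) = \<phi> z + 1"
    and above: "\<And>p z. p \<in> half_space \<Longrightarrow> U1 p \<le> \<phi> z + \<alpha> * (norm (p - z))\<^sup>2"
    and below: "\<And>q z. q \<in> half_space \<Longrightarrow> \<phi> z \<le> V1 q + M + \<alpha> * (norm (q - z))\<^sup>2"
    by blast
  \<comment> \<open>\<open>z\<close> is the midpoint of \<open>p\<close> and \<open>q\<close>, where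
    the parallelogram law is an equality. Both inequalities of the sandwich then become equalities,
    and this is the contact of the two translates.\<close>
  define d where "d = (1 / 2) *\<^sub>R (p - q)"
  define z where "z = p - d"
  have "p = d + d + q" by (simp add: d_def flip: scaleR_add_left)
  then have zq: "z = q - (- d)" by (simp add: z_def)
  have "norm (p - q) = 2 * norm d" by (simp add: d_def)
  then have "(norm (p - q))\<^sup>2 = 4 * (norm d)\<^sup>2" by (simp add: power_mult_distrib)
  then have "\<alpha> / 2 * (norm (p - q))\<^sup>2 = 2 * (\<alpha> * (norm d)\<^sup>2)" by simp
  then have M: "U1 p = V1 q + M + 2 * (\<alpha> * (norm d)\<^sup>2)" unfolding M_def by linarith
  have "p - z = d" "q - z = - d" unfolding z_def by simp (simp add: zq[unfolded z_def])
  then have "U1 p \<le> \<phi> z + \<alpha> * (norm d)\<^sup>2" "\<phi> z \<le> V1 q + M + \<alpha> * (norm d)\<^sup>2"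
    using above[OF pq(1), of z] below[OF pq(2), of z] by simp_all
  with M have \<phi>z: "U1 p = \<phi> z + \<alpha> * (norm d)\<^sup>2" "\<phi> z = V1 q + M + \<alpha> * (norm d)\<^sup>2"
    by linarith+
  obtain tp xp tq xq where eq: "p = (tp, xp)" "q = (tq, xq)" by (metis surj_pair)
  have aboveU: "U p' \<le> \<phi> (p' - d) + H (fst p') + (\<alpha> * (norm d)\<^sup>2 + e)" if "p' \<in> half_space" for p'
    using above[OF that, of "p' - d"] by (simp add: U1_def)
  have touchU: "U (tp, xp) = \<phi> z + H tp + (\<alpha> * (norm d)\<^sup>2 + e)"
    using \<phi>z(1) by (simp add: U1_def eq)
  have belowV: "\<phi> (q' - (- d)) + - H (fst q') + (- M - \<alpha> * (norm d)\<^sup>2) \<le> V q'"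
    if "q' \<in> half_space" for q'
    using below[OF that, of "q' - (- d)"] by (simp add: V1_def)
  have touchV: "V (tq, xq) = \<phi> z + - H tq + (- M - \<alpha> * (norm d)\<^sup>2)"
    using \<phi>z(2) by (simp add: V1_def eq)
  define P where "P = snd (\<xi> z)"
  \<comment> \<open>The slope bound is read off from the contact with \<open>U\<close>; as
    \<open>\<phi>\<close> has a single gradient at \<open>z\<close>, it also gives the nonzero slope
    required on the side of \<open>V\<close>.\<close>
  have "m \<le> P"
    unfolding P_def
    by (rule touching_above_imp_slope_ge[OF D grow(1), of tp d "\<lambda>s. H s + (\<alpha> * (norm d)\<^sup>2 + e)" xp])
      (use aboveU touchU pq(3) in \<open>auto simp: eq z_def algebra_simps\<close>)
  with grow(2) have "P > 0" by simp
  \<comment> \<open>After division by the slope \<open>P\<close>, each perturbation of the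
    half-Laplacian is at most \<open>\<eta>\<close>.\<close>
  define \<kappa> where "\<kappa> = \<eta> * P"
  have "\<kappa> > 0" using \<open>\<eta> > 0\<close> \<open>P > 0\<close> by (simp add: \<kappa>_def)
  define A where "A = A0 (\<lambda>x. \<phi> (fst z, x)) (snd z)"
  have "snd (\<xi> z) \<noteq> 0" using \<open>P > 0\<close> by (simp add: P_def)
  have maxP: "max (snd (\<xi> z)) 0 = P" using \<open>P > 0\<close> by (simp add: P_def)
  have "\<exists>e. \<bar>e\<bar> \<le> \<kappa> \<and> fst (\<xi> z) + H' tp + 1 / pi * (arctan ((A + e) / P) + pi / 2) \<le> 0"
    unfolding A_def maxP[symmetric]
    by (rule subsolution_touching[OF U D Lip shift H H'cont _ aboveU touchU _ \<open>snd (\<xi> z) \<noteq> 0\<close> \<open>\<kappa> > 0\<close>])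
      (use pq(3) in \<open>auto simp: eq z_def\<close>)
  then obtain e1 where e1: "\<bar>e1\<bar> \<le> \<kappa>"
    "fst (\<xi> z) + H' tp + 1 / pi * (arctan ((A + e1) / P) + pi / 2) \<le> 0"
    by blast
  have H2: "((\<lambda>s. - H s) has_real_derivative - H' s) (at s)" for s
    using H by (rule DERIV_minus)
  have H2': "continuous_on UNIV (\<lambda>s. - H' s)" using H'cont by (intro continuous_intros)
  have "\<exists>e. \<bar>e\<bar> \<le> \<kappa> \<and> fst (\<xi> z) + - H' tq + 1 / pi * (arctan ((A + e) / P) + pi / 2) \<ge> 0"
    unfolding A_def maxP[symmetric]
    by (rule supersolution_touching[OF V D Lip shift H2 H2' _ belowV touchV _ \<open>snd (\<xi> z) \<noteq> 0\<close> \<open>\<kappa> > 0\<close>])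
      (use pq(4) zq in \<open>auto simp: eq\<close>)
  then obtain e2 where e2: "\<bar>e2\<bar> \<le> \<kappa>"
    "fst (\<xi> z) + - H' tq + 1 / pi * (arctan ((A + e2) / P) + pi / 2) \<ge> 0"
    by blast
  have "arctan ((A + e2) / P) - arctan ((A + e1) / P) \<le> 2 * \<eta>"
  proof -
    have "arctan ((A + e2) / P) \<le> arctan ((A + \<kappa>) / P)" "arctan ((A - \<kappa>) / P) \<le> arctan ((A + e1) / P)"
      unfolding arctan_le_iff using e1(1) e2(1) \<open>P > 0\<close> by (auto intro!: divide_right_mono)
    moreover have "arctan ((A + \<kappa>) / P) - arctan ((A - \<kappa>) / P) \<le> (A + \<kappa>) / P - (A - \<kappa>) / P"
      using \<open>P > 0\<close> \<open>\<kappa> > 0\<close> by (intro arctan_diff_le divide_right_mono) auto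
    moreover have "(A + \<kappa>) / P - (A - \<kappa>) / P = 2 * \<eta>"
      using \<open>P > 0\<close> by (simp add: \<kappa>_def field_simps)
    ultimately show ?thesis by linarith
  qed
  then have "1 / pi * (arctan ((A + e2) / P) - arctan ((A + e1) / P)) \<le> 1 / pi * (2 * \<eta>)"
    by (intro mult_left_mono) auto
  \<comment> \<open>The factor \<open>1 / pi\<close> of the equation supplies the strict inequality
    against \<open>H' tp + H' tq \<ge> 2 * \<eta>\<close>.\<close>
  also have "\<dots> < 2 * \<eta>" using \<open>\<eta> > 0\<close> pi_gt3 by (simp add: divide_less_eq)
  finally have "1 / pi * (arctan ((A + e2) / P) + pi / 2) - 1 / pi * (arctan ((A + e1) / P) + pi / 2) < 2 * \<eta>"
    by (simp only: right_diff_distrib distrib_left)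
  then show False using e1(2) e2(2) H'ge[of tp] H'ge[of tq] by linarith
qed


section \<open>Distribution functions on the circle\<close>

lemma emeasure_circle_shift:
  assumes "circle_prob \<mu>" "A \<in> sets borel"
  shows "emeasure \<mu> ((\<lambda>x. x + 2 * pi) -` A) = emeasure \<mu> A"
proof -
  have sets: "sets \<mu> = sets borel" and inv: "distr \<mu> borel (\<lambda>x. x + 2 * pi) = \<mu>"
    using assms(1) by (auto simp: circle_prob_def)
  have [measurable_cong]: "sets \<mu> = sets borel" by fact
  have "space \<mu> = UNIV" using sets_eq_imp_space_eq[OF sets] by simp
  moreover have "emeasure (distr \<mu> borel (\<lambda>x. x + 2 * pi)) A
      = emeasure \<mu> ((\<lambda>x. x + 2 * pi) -` A \<inter> space \<mu>)"
    by (rule emeasure_distr) (simp_all add: assms(2) measurable_cong_sets[OF sets refl])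
  ultimately show ?thesis by (simp add: inv)
qed

lemma emeasure_circle_period:
  assumes "circle_prob \<mu>"
  shows "emeasure \<mu> {0..<2 * pi} = 1"
proof -
  have sets: "sets \<mu> = sets borel" and "prob_space (one_period \<mu>)"
    using assms by (auto simp: circle_prob_def)
  then have "emeasure (one_period \<mu>) (space (one_period \<mu>)) = 1"
    using prob_space.emeasure_space_1 by blast
  moreover have "space \<mu> = UNIV" using sets_eq_imp_space_eq[OF sets] by simp
  ultimately show ?thesis
    by (simp add: one_period_def space_restrict_space emeasure_restrict_space sets)
qed

text \<open>The lift has infinite total mass, and \<open>measure\<close> is additive only where the
  mass is finite. Finiteness on bounded sets is built up one period at a time, to the right and to
  the left of 0.\<close>

lemma circle_prob_bounded_fmeasurable:
  assumes "circle_prob \<mu>" "A \<in> sets borel" "A \<subseteq> {a..b}"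
  shows "A \<in> fmeasurable \<mu>"
proof -
  have sets: "sets \<mu> = sets borel" using assms(1) by (auto simp: circle_prob_def)
  note shift = emeasure_circle_shift[OF assms(1)]
  have pos: "emeasure \<mu> {0..<2 * pi * real n} < \<infinity>" for n
  proof (induction n)
    case (Suc n)
    have "emeasure \<mu> {0..<2 * pi * real (Suc n)}
        \<le> emeasure \<mu> ({0..<2 * pi} \<union> {2 * pi..<2 * pi * real (Suc n)})"
      by (intro emeasure_mono) (auto simp: sets)
    also have "\<dots> \<le> emeasure \<mu> {0..<2 * pi} + emeasure \<mu> {2 * pi..<2 * pi * real (Suc n)}"
      by (intro emeasure_subadditive) (auto simp: sets)
    also have "(\<lambda>x. x + 2 * pi) -` {2 * pi..<2 * pi * real (Suc n)} = {0..<2 * pi * real n}"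
      by (auto simp: algebra_simps)
    then have "emeasure \<mu> {2 * pi..<2 * pi * real (Suc n)} = emeasure \<mu> {0..<2 * pi * real n}"
      using shift[of "{2 * pi..<2 * pi * real (Suc n)}"] by simp
    also have "emeasure \<mu> {0..<2 * pi} + emeasure \<mu> {0..<2 * pi * real n} < \<infinity>"
      using Suc emeasure_circle_period[OF assms(1)] by (simp add: less_top[symmetric])
    finally show ?case .
  qed simp
  have neg: "emeasure \<mu> {- (2 * pi * real n)..<0} < \<infinity>" for n
  proof (induction n)
    case (Suc n)
    have "emeasure \<mu> {- (2 * pi * real (Suc n))..<0}
        \<le> emeasure \<mu> ({- (2 * pi * real (Suc n))..<- (2 * pi)} \<union> {- (2 * pi)..<0})"
      by (intro emeasure_mono) (auto simp: sets)
    also have "\<dots> \<le> emeasure \<mu> {- (2 * pi * real (Suc n))..<- (2 * pi)} + emeasure \<mu> {- (2 * pi)..<0}"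
      by (intro emeasure_subadditive) (auto simp: sets)
    also have "(\<lambda>x. x + 2 * pi) -` {- (2 * pi * real n)..<0} = {- (2 * pi * real (Suc n))..<- (2 * pi)}"
      by (auto simp: algebra_simps)
    then have "emeasure \<mu> {- (2 * pi * real (Suc n))..<- (2 * pi)} = emeasure \<mu> {- (2 * pi * real n)..<0}"
      using shift[of "{- (2 * pi * real n)..<0}"] by simp
    also have "(\<lambda>x. x + 2 * pi) -` {0..<2 * pi} = {- (2 * pi)..<0}" by (auto simp: algebra_simps)
    then have "emeasure \<mu> {- (2 * pi)..<0} = 1"
      using shift[of "{0..<2 * pi}"] emeasure_circle_period[OF assms(1)] by simp
    also have "emeasure \<mu> {- (2 * pi * real n)..<0} + 1 < \<infinity>"
      using Suc by (simp add: less_top[symmetric])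
    finally show ?case .
  qed simp
  obtain n where n: "\<bar>a\<bar> + \<bar>b\<bar> < real n * (2 * pi)"
    using reals_Archimedean3[of "2 * pi"] pi_gt_zero by (metis mult_pos_pos zero_less_numeral)
  have "emeasure \<mu> A \<le> emeasure \<mu> ({- (2 * pi * real n)..<0} \<union> {0..<2 * pi * real n})"
    using assms(3) n by (intro emeasure_mono) (force simp: sets algebra_simps)+
  also have "\<dots> \<le> emeasure \<mu> {- (2 * pi * real n)..<0} + emeasure \<mu> {0..<2 * pi * real n}"
    by (intro emeasure_subadditive) (auto simp: sets)
  also have "\<dots> < \<infinity>" using pos[of n] neg[of n] by (simp add: ennreal_add_less_top less_top[symmetric])
  finally show ?thesis using assms(2) sets by (auto simp: fmeasurable_def)
qed

text \<open>The cases follow the position of 0 relative to \<open>x\<close> and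
  \<open>x + 2 * pi\<close>, since the formula for \<open>circle_cdf\<close> changes there. In each
  of them an interval is split so that one period of mass 1 separates off or, in the middle case, is
  itself cut at \<open>x + 2 * pi\<close>.\<close>

lemma circle_cdf_shift:
  assumes "circle_prob \<mu>"
  shows "circle_cdf \<mu> (x + 2 * pi) = circle_cdf \<mu> x + 1"
proof -
  have fm: "A \<in> fmeasurable \<mu>" if "A \<in> sets borel" "A \<subseteq> {a..b}" for A a b
    by (rule circle_prob_bounded_fmeasurable[OF assms that])
  have shift: "measure \<mu> ((\<lambda>x. x + 2 * pi) -` A) = measure \<mu> A" if "A \<in> sets borel" for A
    using emeasure_circle_shift[OF assms that] by (simp add: measure_def)
  have period: "measure \<mu> {0..<2 * pi} = 1"
    using emeasure_circle_period[OF assms] by (simp add: measure_def)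
  have union: "measure \<mu> (A \<union> B) = measure \<mu> A + measure \<mu> B"
    if "A \<in> sets borel" "B \<in> sets borel" "A \<subseteq> {a..b}" "B \<subseteq> {a..b}" "A \<inter> B = {}" for A B a b
    using that fm[OF that(1,3)] fm[OF that(2,4)]
    by (intro measure_Union) (auto simp: fmeasurable_def)
  consider "x \<ge> 0" | "- (2 * pi) \<le> x" "x < 0" | "x < - (2 * pi)" by linarith
  then show ?thesis
  proof cases
    case 1
    have "{0..x + 2 * pi} = {0..<2 * pi} \<union> {2 * pi..x + 2 * pi}"
      using 1 by (intro ivl_disj_un_two(7)[symmetric]) auto
    also have "measure \<mu> \<dots> = measure \<mu> {0..<2 * pi} + measure \<mu> {2 * pi..x + 2 * pi}"
      using 1 by (intro union[of _ _ 0 "x + 2 * pi"]) (auto intro: order_trans[of 0 "2 * pi"])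
    also have "(\<lambda>x. x + 2 * pi) -` {2 * pi..x + 2 * pi} = {0..x}" by auto
    then have "measure \<mu> {2 * pi..x + 2 * pi} = measure \<mu> {0..x}"
      using shift[of "{2 * pi..x + 2 * pi}"] by simp
    finally show ?thesis using 1 period by (simp add: circle_cdf_def)
  next
    case 2
    have "{0..<2 * pi} = {0..x + 2 * pi} \<union> {x + 2 * pi<..<2 * pi}" using 2 by auto
    also have "measure \<mu> \<dots> = measure \<mu> {0..x + 2 * pi} + measure \<mu> {x + 2 * pi<..<2 * pi}"
      using 2 by (intro union[of _ _ 0 "2 * pi"]) auto
    also have "(\<lambda>x. x + 2 * pi) -` {x + 2 * pi<..<2 * pi} = {x<..<0}" by auto
    then have "measure \<mu> {x + 2 * pi<..<2 * pi} = measure \<mu> {x<..<0}"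
      using shift[of "{x + 2 * pi<..<2 * pi}"] by simp
    finally show ?thesis using 2 period by (simp add: circle_cdf_def)
  next
    case 3
    have "{x<..<0} = {x<..<- (2 * pi)} \<union> {- (2 * pi)..<0}"
      using 3 by (intro ivl_disj_un_two(1)[symmetric]) auto
    also have "measure \<mu> \<dots> = measure \<mu> {x<..<- (2 * pi)} + measure \<mu> {- (2 * pi)..<0}"
    proof (rule union[of _ _ x 0])
      show "{x<..<- (2 * pi)} \<subseteq> {x..0}"
      proof
        fix y assume "y \<in> {x<..<- (2 * pi)}"
        then have "x < y" "y < - (2 * pi)" by auto
        then have "x \<le> y" "y \<le> 0" using pi_gt_zero by linarith+
        then show "y \<in> {x..0}" by simp
      qed
    qed (use 3 in auto)
    also have "(\<lambda>x. x + 2 * pi) -` {x + 2 * pi<..<0} = {x<..<- (2 * pi)}" by auto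
    then have "measure \<mu> {x<..<- (2 * pi)} = measure \<mu> {x + 2 * pi<..<0}"
      using shift[of "{x + 2 * pi<..<0}"] by simp
    also have "(\<lambda>x. x + 2 * pi) -` {0..<2 * pi} = {- (2 * pi)..<0}" by auto
    then have "measure \<mu> {- (2 * pi)..<0} = 1"
      using shift[of "{0..<2 * pi}"] period by simp
    finally have "measure \<mu> {x<..<0} = measure \<mu> {x + 2 * pi<..<0} + 1" .
    moreover have "x < 0" using 3 pi_gt_zero by linarith
    ultimately show ?thesis using 3 by (simp add: circle_cdf_def)
  qed
qed

lemma circle_cdf_eq_measure_one_period:
  assumes "circle_prob \<mu>" "x \<in> {0..<2 * pi}"
  shows "circle_cdf \<mu> x = measure (one_period \<mu>) {0..x}"
proof -
  have sets: "sets \<mu> = sets borel" using assms(1) by (auto simp: circle_prob_def)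
  then have "space \<mu> = UNIV" using sets_eq_imp_space_eq[OF sets] by simp
  then have "measure (restrict_space \<mu> {0..<2 * pi}) {0..x} = measure \<mu> {0..x}"
    using assms(2) by (intro measure_restrict_space) (auto simp: sets)
  then show ?thesis using assms(2) by (simp add: circle_cdf_def one_period_def)
qed

text \<open>The difference is periodic, and on one period both terms lie between 0 and 1. This later
  identifies the jump of the solutions.\<close>

lemma circle_cdf_near_linear:
  assumes "circle_prob \<mu>"
  shows "\<bar>circle_cdf \<mu> x - x / (2 * pi)\<bar> \<le> 1"
proof -
  interpret prob_space "one_period \<mu>" using assms by (simp add: circle_prob_def)
  obtain k :: int where k: "x + of_int k * (2 * pi) \<in> {0..<2 * pi}"
    using ex_shift_into_period[of "2 * pi" x] by auto
  define y where "y = x + of_int k * (2 * pi)"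
  have "0 \<le> circle_cdf \<mu> y" "circle_cdf \<mu> y \<le> 1"
    using circle_cdf_eq_measure_one_period[OF assms k] by (simp_all add: y_def)
  moreover have "0 \<le> y / (2 * pi)" "y / (2 * pi) \<le> 1" using k by (simp_all add: y_def[symmetric] divide_le_eq)
  moreover have "y / (2 * pi) = x / (2 * pi) + of_int k"
    by (simp add: y_def add_divide_distrib)
  moreover have "circle_cdf \<mu> y = circle_cdf \<mu> x + of_int k"
    using shift_of_int[of "circle_cdf \<mu>" "2 * pi" 1 x k] circle_cdf_shift[OF assms]
    by (simp add: y_def)
  ultimately show ?thesis by linarith
qed

section \<open>From convergence in law to uniform convergence of distribution functions\<close>

lemma absolutely_continuous_imp_null_one_period:
  assumes "circle_prob \<nu>" "absolutely_continuous lborel \<nu>" "finite A"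
  shows "measure (one_period \<nu>) (A \<inter> {0..<2 * pi}) = 0"
proof -
  have sets: "sets \<nu> = sets borel" using assms(1) by (auto simp: circle_prob_def)
  then have "space \<nu> = UNIV" using sets_eq_imp_space_eq[OF sets] by simp
  moreover have "A \<inter> {0..<2 * pi} \<in> null_sets \<nu>"
    using assms(2,3) unfolding absolutely_continuous_def
    by (meson finite_Int finite_imp_null_set_lborel subsetD)
  ultimately show ?thesis
    by (simp add: one_period_def measure_restrict_space sets measure_eq_0_null_sets)
qed

text \<open>Pushing forward by the periodic function \<open>\<theta> \<mapsto> - cos (\<theta> - x / 2)\<close> reduces convergence in law on
  the circle to weak convergence on the line.\<close>

lemma arc_eq_cos_sublevel:
  assumes x: "x \<in> {0..<2 * pi}" and \<theta>: "\<theta> \<in> {0..<2 * pi}"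
  shows "- cos (\<theta> - x / 2) \<le> - cos (x / 2) \<longleftrightarrow> \<theta> \<le> x"
    and "- cos (\<theta> - x / 2) = - cos (x / 2) \<Longrightarrow> \<theta> \<in> {0, x}"
proof -
  have far: "cos (\<theta> - x / 2) < cos (x / 2)" if "\<theta> > x"
  proof (cases "\<theta> - x / 2 \<le> pi")
    case True
    then show ?thesis using that x by (intro cos_monotone_0_pi) auto
  next
    case False
    then have "cos (2 * pi - (\<theta> - x / 2)) < cos (x / 2)"
      using that x \<theta> by (intro cos_monotone_0_pi) auto
    then show ?thesis by (simp add: cos_2pi_minus)
  qed
  have near: "cos (x / 2) \<le> cos (\<theta> - x / 2)" if "\<theta> \<le> x"
  proof -
    have "cos (x / 2) \<le> cos \<bar>\<theta> - x / 2\<bar>"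
      using that x \<theta> by (intro cos_monotone_0_pi_le) (auto simp: abs_if)
    then show ?thesis by simp
  qed
  have inner: "cos (x / 2) < cos (\<theta> - x / 2)" if "0 < \<theta>" "\<theta> < x"
  proof -
    have "cos (x / 2) < cos \<bar>\<theta> - x / 2\<bar>"
      using that x \<theta> by (intro cos_monotone_0_pi) (auto simp: abs_if)
    then show ?thesis by simp
  qed
  show "- cos (\<theta> - x / 2) \<le> - cos (x / 2) \<longleftrightarrow> \<theta> \<le> x"
    using far near by fastforce
  show "\<theta> \<in> {0, x}" if "- cos (\<theta> - x / 2) = - cos (x / 2)"
    using that far inner \<theta> by fastforce
qed

lemma circle_conv_in_law_imp_cdf_tendsto:
  assumes \<mu>: "\<And>n. circle_prob (\<mu> n)" and \<nu>: "circle_prob \<nu>"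
    and conv: "circle_conv_in_law \<mu> \<nu>" and ac: "absolutely_continuous lborel \<nu>"
  shows "(\<lambda>n. circle_cdf (\<mu> n) x) \<longlonglongrightarrow> circle_cdf \<nu> x"
proof -
  have main: "(\<lambda>n. circle_cdf (\<mu> n) x) \<longlonglongrightarrow> circle_cdf \<nu> x" if x: "x \<in> {0..<2 * pi}" for x
  proof -
    \<comment> \<open>Centred at the midpoint \<open>x / 2\<close> of the arc from 0 to
      \<open>x\<close>, so that within one period this arc is a sublevel set of a continuous
      periodic function.\<close>
    define u where "u \<theta> = - cos (\<theta> - x / 2)" for \<theta> :: real
    define D where "D \<rho> = distr (one_period \<rho>) borel u" for \<rho>
    have meas: "u \<in> borel_measurable (one_period \<rho>)" if "circle_prob \<rho>" for \<rho>
    proof -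
      have "sets \<rho> = sets borel" using that by (simp add: circle_prob_def)
      then have [measurable_cong]: "sets \<rho> = sets borel" .
      have "u \<in> borel_measurable borel" unfolding u_def[abs_def] by measurable
      then have "u \<in> borel_measurable \<rho>" by (simp add: \<open>sets \<rho> = sets borel\<close> cong: measurable_cong_sets)
      then show ?thesis unfolding one_period_def by (rule measurable_restrict_space1)
    qed
    have D: "real_distribution (D \<rho>)" if "circle_prob \<rho>" for \<rho>
      unfolding D_def using that meas[OF that]
      by (intro prob_space.real_distribution_distr) (auto simp: circle_prob_def)
    have space: "space (one_period \<rho>) = {0..<2 * pi}" if "circle_prob \<rho>" for \<rho>
    proof -
      have "sets \<rho> = sets borel" using that by (simp add: circle_prob_def)
      then show ?thesis using sets_eq_imp_space_eq[of \<rho> borel]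
        by (simp add: one_period_def space_restrict_space)
    qed
    have cdf: "cdf (D \<rho>) (- cos (x / 2)) = circle_cdf \<rho> x" if \<rho>: "circle_prob \<rho>" for \<rho>
    proof -
      have "cdf (D \<rho>) (- cos (x / 2)) = measure (one_period \<rho>) (u -` {..- cos (x / 2)} \<inter> {0..<2 * pi})"
        unfolding cdf_def D_def using meas[OF \<rho>] by (simp add: measure_distr space[OF \<rho>])
      also have "u -` {..- cos (x / 2)} \<inter> {0..<2 * pi} = {0..x}"
        using x arc_eq_cos_sublevel(1)[OF x] by (force simp: u_def)
      finally show ?thesis using circle_cdf_eq_measure_one_period[OF \<rho> x] by simp
    qed
    have "weak_conv_m (\<lambda>n. D (\<mu> n)) (D \<nu>)"
    proof (rule integral_bdd_continuous_conv_imp_weak_conv)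
      show "real_distribution (D (\<mu> n))" for n by (rule D[OF \<mu>])
      show "real_distribution (D \<nu>)" by (rule D[OF \<nu>])
      fix f :: "real \<Rightarrow> real" assume f: "\<And>x. isCont f x"
      then have fm: "f \<in> borel_measurable borel"
        by (intro borel_measurable_continuous_onI continuous_at_imp_continuous_on) auto
      have int: "integral\<^sup>L (D \<rho>) f = (\<integral>\<theta>. f (u \<theta>) \<partial>one_period \<rho>)" if "circle_prob \<rho>" for \<rho>
        unfolding D_def using meas[OF that] fm by (rule integral_distr)
      have "continuous_on UNIV f" using f by (simp add: continuous_at_imp_continuous_on)
      then have "continuous_on UNIV (\<lambda>\<theta>. f (u \<theta>))"
        unfolding u_def by (rule continuous_on_compose2) (auto intro!: continuous_intros)
      moreover have "f (u (\<theta> + 2 * pi)) = f (u \<theta>)" for \<theta>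
        using cos_periodic[of "\<theta> - x / 2"] by (simp add: u_def algebra_simps)
      ultimately have "(\<lambda>n. \<integral>\<theta>. f (u \<theta>) \<partial>one_period (\<mu> n)) \<longlonglongrightarrow> (\<integral>\<theta>. f (u \<theta>) \<partial>one_period \<nu>)"
        using conv unfolding circle_conv_in_law_def by blast
      then show "(\<lambda>n. integral\<^sup>L (D (\<mu> n)) f) \<longlonglongrightarrow> integral\<^sup>L (D \<nu>) f"
        by (simp add: int \<mu> \<nu>)
    qed
    \<comment> \<open>Weak convergence speaks only of continuity points. An atom at this level would
      need mass at 0 or \<open>x\<close>, the ends of the arc, which absolute continuity
      excludes.\<close>
    moreover have "isCont (cdf (D \<nu>)) (- cos (x / 2))"
    proof -
      interpret real_distribution "D \<nu>" by (rule D[OF \<nu>])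
      interpret N: prob_space "one_period \<nu>" using \<nu> by (simp add: circle_prob_def)
      have "measure (D \<nu>) {- cos (x / 2)} = measure (one_period \<nu>) (u -` {- cos (x / 2)} \<inter> {0..<2 * pi})"
        unfolding D_def using meas[OF \<nu>] by (simp add: measure_distr space[OF \<nu>])
      also have "\<dots> \<le> measure (one_period \<nu>) ({0, x} \<inter> {0..<2 * pi})"
      proof (rule N.finite_measure_mono)
        show "u -` {- cos (x / 2)} \<inter> {0..<2 * pi} \<subseteq> {0, x} \<inter> {0..<2 * pi}"
        proof
          fix \<theta> assume "\<theta> \<in> u -` {- cos (x / 2)} \<inter> {0..<2 * pi}"
          then have "\<theta> \<in> {0..<2 * pi}" "- cos (\<theta> - x / 2) = - cos (x / 2)" by (auto simp: u_def)
          then show "\<theta> \<in> {0, x} \<inter> {0..<2 * pi}" using arc_eq_cos_sublevel(2)[OF x] by blast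
        qed
        show "{0, x} \<inter> {0..<2 * pi} \<in> sets (one_period \<nu>)"
          using \<nu> by (auto simp: one_period_def circle_prob_def sets_restrict_space)
      qed
      also have "\<dots> = 0" by (rule absolutely_continuous_imp_null_one_period[OF \<nu> ac]) simp
      finally show ?thesis by (simp add: isCont_cdf measure_le_0_iff)
    qed
    ultimately show ?thesis
      unfolding weak_conv_m_def weak_conv_def using cdf \<mu> \<nu> by auto
  qed
  obtain k :: int where k: "x + of_int k * (2 * pi) \<in> {0..<2 * pi}"
    using ex_shift_into_period[of "2 * pi" x] by auto
  have eq: "circle_cdf \<rho> x = circle_cdf \<rho> (x + of_int k * (2 * pi)) - of_int k" if "circle_prob \<rho>" for \<rho>
    using shift_of_int[of "circle_cdf \<rho>" "2 * pi" 1 x k] circle_cdf_shift[OF that] by simp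
  show ?thesis unfolding eq[OF \<mu>] eq[OF \<nu>] by (intro tendsto_diff main[OF k] tendsto_const)
qed

text \<open>On the line, a distribution function is continuous where there is no atom. The mass of
  one period gives such a function \<open>Q\<close>, and \<open>circle_cdf\<close> is glued from
  translates of it, which also covers the seams between periods.\<close>

lemma isCont_circle_cdf:
  assumes \<nu>: "circle_prob \<nu>" and ac: "absolutely_continuous lborel \<nu>"
  shows "isCont (circle_cdf \<nu>) x"
proof -
  have sets: "sets \<nu> = sets borel" using \<nu> by (auto simp: circle_prob_def)
  then have "space \<nu> = UNIV" using sets_eq_imp_space_eq[OF sets] by simp
  then have space: "space (one_period \<nu>) = {0..<2 * pi}"
    by (simp add: one_period_def space_restrict_space)
  interpret N: prob_space "one_period \<nu>" using \<nu> by (simp add: circle_prob_def)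
  define D where "D = distr (one_period \<nu>) borel (\<lambda>x. x)"
  have meas: "(\<lambda>x::real. x) \<in> borel_measurable (one_period \<nu>)"
    unfolding one_period_def
    by (intro measurable_restrict_space1) (simp add: measurable_cong_sets[OF sets refl])
  interpret D: real_distribution D unfolding D_def using meas by (rule N.real_distribution_distr)
  have mD: "measure D A = measure (one_period \<nu>) (A \<inter> {0..<2 * pi})" if "A \<in> sets borel" for A
    unfolding D_def using meas that by (simp add: measure_distr space)
  define Q where "Q = cdf D"
  have Qcont: "isCont Q y" for y
    unfolding Q_def D.isCont_cdf
    using absolutely_continuous_imp_null_one_period[OF \<nu> ac, of "{y}"] mD[of "{y}"] by simp
  have Q0: "Q y = 0" if "y < 0" for y
  proof -
    have "{..y} \<inter> {0..<2 * pi} = {}" using that by auto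
    then show ?thesis by (simp add: Q_def cdf_def mD)
  qed
  have Q1: "Q y = 1" if "y \<ge> 2 * pi" for y
  proof -
    have "{..y} \<inter> {0..<2 * pi} = {0..<2 * pi}" using that by auto
    then show ?thesis using N.prob_space space by (simp add: Q_def cdf_def mD)
  qed
  have Qc: "Q y = circle_cdf \<nu> y" if "y \<in> {0..<2 * pi}" for y
  proof -
    have "{..y} \<inter> {0..<2 * pi} = {0..y}" using that by auto
    then show ?thesis using circle_cdf_eq_measure_one_period[OF \<nu> that] by (simp add: Q_def cdf_def mD)
  qed
  \<comment> \<open>At each \<open>y\<close> one of the three translates is active and the others
    are constant 0 or 1. The open interval contains the period \<open>{0..<2 * pi}\<close> in its
    interior, so continuity at 0 is two-sided.\<close>
  have eq: "Q (y + 2 * pi) + Q y + Q (y - 2 * pi) - 1 = circle_cdf \<nu> y"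
    if "y \<in> {- (2 * pi)<..<4 * pi}" for y
  proof -
    consider "y < 0" | "0 \<le> y" "y < 2 * pi" | "2 * pi \<le> y" by linarith
    then show ?thesis
    proof cases
      case 1
      then show ?thesis using Q0[of y] Q0[of "y - 2 * pi"] Qc[of "y + 2 * pi"] that
          circle_cdf_shift[OF \<nu>, of y] by auto
    next
      case 2
      then show ?thesis using Q1[of "y + 2 * pi"] Q0[of "y - 2 * pi"] Qc[of y] by auto
    next
      case 3
      then show ?thesis using Q1[of "y + 2 * pi"] Q1[of y] Qc[of "y - 2 * pi"] that
          circle_cdf_shift[OF \<nu>, of "y - 2 * pi"] by auto
    qed
  qed
  obtain k :: int where k: "x + of_int k * (2 * pi) \<in> {0..<2 * pi}"
    using ex_shift_into_period[of "2 * pi" x] by auto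
  define z where "z = x + of_int k * (2 * pi)"
  have Qcomp: "isCont (\<lambda>y. Q (y + c)) z" for c
    by (rule isCont_o2[OF _ Qcont]) (intro continuous_intros)
  have "isCont (\<lambda>y. Q (y + 2 * pi) + Q (y + 0) + Q (y + (- (2 * pi))) - 1) z"
    by (intro continuous_intros Qcomp)
  then have "isCont (\<lambda>y. Q (y + 2 * pi) + Q y + Q (y - 2 * pi) - 1) z" by simp
  moreover have ev: "\<forall>\<^sub>F y in nhds z. Q (y + 2 * pi) + Q y + Q (y - 2 * pi) - 1 = circle_cdf \<nu> y"
  proof (rule eventually_mono)
    show "\<forall>\<^sub>F y in nhds z. y \<in> {- (2 * pi)<..<4 * pi}"
      using k by (intro eventually_nhds_in_open) (auto simp: z_def[symmetric])
  qed (rule eq)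
  ultimately have "isCont (circle_cdf \<nu>) z" using isCont_cong[OF ev] by blast
  moreover have "isCont (\<lambda>y. y + of_int k * (2 * pi)) x" by (intro continuous_intros)
  ultimately have "isCont (\<lambda>y. circle_cdf \<nu> (y + of_int k * (2 * pi))) x"
    unfolding z_def by (rule isCont_o2[rotated])
  then have "isCont (\<lambda>y. circle_cdf \<nu> (y + of_int k * (2 * pi)) - of_int k) x"
    by (rule continuous_diff) (rule continuous_const)
  moreover have "circle_cdf \<nu> (y + of_int k * (2 * pi)) - of_int k = circle_cdf \<nu> y" for y
    using shift_of_int[of "circle_cdf \<nu>" "2 * pi" 1 y k] circle_cdf_shift[OF \<nu>] by simp
  ultimately show ?thesis by simp
qed

text \<open>A Dini-type argument: on a finite mesh where \<open>g\<close> varies by less than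
  \<open>e / 2\<close> between neighbours, pointwise convergence is uniform, and monotonicity
  squeezes \<open>f n\<close> between mesh values. The common jump \<open>c\<close> reduces the line
  to one period.\<close>

lemma mono_tendsto_continuous_imp_uniform:
  fixes f :: "nat \<Rightarrow> real \<Rightarrow> real" and g :: "real \<Rightarrow> real"
  assumes mono: "\<And>n. mono (f n)" and lim: "\<And>x. (\<lambda>n. f n x) \<longlonglongrightarrow> g x"
    and cont: "continuous_on UNIV g" and "T > 0" "e > 0"
    and fshift: "\<And>n x. f n (x + T) = f n x + c" and gshift: "\<And>x. g (x + T) = g x + c"
  shows "\<forall>\<^sub>F n in sequentially. \<forall>x. \<bar>f n x - g x\<bar> \<le> e"
proof -
  have "uniformly_continuous_on {0..T} g"
    using cont by (intro compact_uniformly_continuous) (auto intro: continuous_on_subset)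
  then obtain \<delta> where "\<delta> > 0" and \<delta>: "\<And>x y. x \<in> {0..T} \<Longrightarrow> y \<in> {0..T} \<Longrightarrow> dist y x < \<delta> \<Longrightarrow> dist (g y) (g x) < e / 2"
    using \<open>e > 0\<close> unfolding uniformly_continuous_on_def by (metis half_gt_zero)
  obtain N :: nat where N: "T / \<delta> < real N" using reals_Archimedean2 by blast
  have "0 < T / \<delta>" using \<open>T > 0\<close> \<open>\<delta> > 0\<close> by simp
  with N have Npos: "0 < real N" by linarith
  have mesh: "T / real N < \<delta>" using N Npos \<open>\<delta> > 0\<close> by (simp add: field_simps)
  define y where "y i = T * real i / real N" for i
  have "\<forall>\<^sub>F n in sequentially. \<forall>i\<in>{..N}. \<bar>f n (y i) - g (y i)\<bar> < e / 2"
  proof (intro eventually_ball_finite ballI)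
    show "\<forall>\<^sub>F n in sequentially. \<bar>f n (y i) - g (y i)\<bar> < e / 2" for i
      using tendstoD[OF lim[of "y i"], of "e / 2"] \<open>e > 0\<close> by (simp add: dist_real_def)
  qed simp
  then show ?thesis
  proof eventually_elim
    case (elim n)
    have "\<bar>f n x - g x\<bar> \<le> e" if x: "x \<in> {0..<T}" for x
    proof -
      define i where "i = nat \<lfloor>x * real N / T\<rfloor>"
      have nn: "0 \<le> x * real N / T" using x \<open>T > 0\<close> by simp
      have "real i \<le> x * real N / T" "x * real N / T < real i + 1"
        unfolding i_def using nn by linarith+
      then have i: "y i \<le> x" "x \<le> y (Suc i)"
        using \<open>T > 0\<close> Npos by (simp_all add: y_def field_simps)
      have "x * real N / T < real N" using x \<open>T > 0\<close> Npos by (simp add: field_simps)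
      with \<open>real i \<le> x * real N / T\<close> have "i < N" by simp
      have step: "y (Suc i) = y i + T / real N"
        by (simp add: y_def distrib_left add_divide_distrib)
      have "y i \<ge> 0" using \<open>T > 0\<close> by (simp add: y_def)
      have "real (Suc i) / real N \<le> 1" using \<open>i < N\<close> by simp
      then have "y (Suc i) \<le> T"
        using mult_left_mono[of "real (Suc i) / real N" 1 T] \<open>T > 0\<close> by (simp add: y_def)
      have "dist (y i) x < \<delta>" "dist (y (Suc i)) x < \<delta>"
        using i step mesh by (simp_all add: dist_real_def)
      moreover have "y i \<in> {0..T}" "y (Suc i) \<in> {0..T}" "x \<in> {0..T}"
        using i \<open>y i \<ge> 0\<close> \<open>y (Suc i) \<le> T\<close> x by auto
      ultimately have "dist (g (y i)) (g x) < e / 2" "dist (g (y (Suc i))) (g x) < e / 2"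
        using \<delta> by blast+
      moreover have "\<bar>f n (y i) - g (y i)\<bar> < e / 2" "\<bar>f n (y (Suc i)) - g (y (Suc i))\<bar> < e / 2"
        using elim \<open>i < N\<close> by (auto simp: Suc_le_eq)
      moreover have "f n (y i) \<le> f n x" "f n x \<le> f n (y (Suc i))" using mono i by (auto dest: monoD)
      ultimately show ?thesis unfolding dist_real_def by linarith
    qed
    moreover have "\<exists>z\<in>{0..<T}. f n x - g x = f n z - g z" for x
    proof -
      obtain k :: int where k: "x + of_int k * T \<in> {0..<T}"
        using ex_shift_into_period[OF \<open>T > 0\<close>, of x] by auto
      then show ?thesis
        using shift_of_int[of "f n" T c x k] shift_of_int[of g T c x k] fshift gshift
        by (intro bexI[of _ "x + of_int k * T"]) simp_all
    qed
    ultimately show ?case by metis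
  qed
qed


section \<open>Envelopes and initial conditions\<close>

text \<open>The filter includes \<open>x\<close> itself, so the upper limit is at least
  \<open>f x\<close>. Local boundedness keeps it below infinity, which \<open>real_of_ereal\<close>
  would send to 0.\<close>

lemma le_upper_envelope:
  assumes "locally_bounded_on \<Omega> f" "x \<in> \<Omega>"
  shows "f x \<le> upper_envelope \<Omega> f x"
proof -
  define L where "L = Limsup (nhds_within x \<Omega>) (\<lambda>y. ereal (f y))"
  obtain C where "\<forall>\<^sub>F y in nhds_within x \<Omega>. \<bar>f y\<bar> \<le> C"
    using assms by (auto simp: locally_bounded_on_def)
  then have "L \<le> ereal C"
    unfolding L_def by (intro Limsup_bounded) (auto elim!: eventually_mono)
  moreover have "ereal (f x) \<le> L"
  proof (rule ccontr)
    assume "\<not> ereal (f x) \<le> L"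
    then have "\<forall>\<^sub>F y in nhds_within x \<Omega>. ereal (f y) < ereal (f x)"
      unfolding L_def by (intro Limsup_lessD) simp
    then show False using assms(2) by (auto simp: eventually_nhds_within)
  qed
  ultimately show ?thesis
    unfolding upper_envelope_def L_def[symmetric] by (cases L) auto
qed

lemma lower_envelope_eq_uminus_upper_envelope:
  "lower_envelope \<Omega> f x = - upper_envelope \<Omega> (\<lambda>y. - f y) x"
  unfolding lower_envelope_def upper_envelope_def
  using ereal_Limsup_uminus[of "nhds_within x \<Omega>" "\<lambda>y. ereal (f y)"] by simp

lemma lower_envelope_le:
  assumes "locally_bounded_on \<Omega> f" "x \<in> \<Omega>"
  shows "lower_envelope \<Omega> f x \<le> f x"
  using le_upper_envelope[of \<Omega> "\<lambda>y. - f y" x] assms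
  by (simp add: lower_envelope_eq_uminus_upper_envelope locally_bounded_on_def)

lemma upper_envelope_le:
  assumes "\<forall>\<^sub>F y in nhds_within x \<Omega>. f y \<le> b" "x \<in> \<Omega>"
  shows "upper_envelope \<Omega> f x \<le> b"
proof -
  define L where "L = Limsup (nhds_within x \<Omega>) (\<lambda>y. ereal (f y))"
  have "L \<le> ereal b"
    unfolding L_def using assms(1) by (intro Limsup_bounded) (auto elim!: eventually_mono)
  moreover have "ereal (f x) \<le> L"
  proof (rule ccontr)
    assume "\<not> ereal (f x) \<le> L"
    then have "\<forall>\<^sub>F y in nhds_within x \<Omega>. ereal (f y) < ereal (f x)"
      unfolding L_def by (intro Limsup_lessD) simp
    then show False using assms(2) by (auto simp: eventually_nhds_within)
  qed
  ultimately show ?thesis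
    unfolding upper_envelope_def L_def[symmetric] by (cases L) auto
qed

lemma le_lower_envelope:
  assumes "\<forall>\<^sub>F y in nhds_within x \<Omega>. b \<le> f y" "x \<in> \<Omega>"
  shows "b \<le> lower_envelope \<Omega> f x"
  using upper_envelope_le[of "\<lambda>y. - f y" "- b" x \<Omega>] assms
  by (simp add: lower_envelope_eq_uminus_upper_envelope)

text \<open>After \<open>n\<close> periods \<open>f\<close> has grown by \<open>n * a\<close> while
  it stays within \<open>B\<close> of a function that has grown by \<open>n\<close>; a large
  \<open>n\<close> decides.\<close>

lemma quasi_periodic_jump_unique:
  fixes f :: "real \<Rightarrow> real"
  assumes shift: "\<And>x. f (x + 2 * pi) = f x + a" and near: "\<And>x. \<bar>f x - x / (2 * pi)\<bar> \<le> B"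
  shows "a = 1"
proof (rule ccontr)
  assume "a \<noteq> 1"
  then have pos: "\<bar>a - 1\<bar> > 0" by simp
  obtain n :: nat where n: "2 * B < real n * \<bar>a - 1\<bar>" using reals_Archimedean3[OF pos] by blast
  have "f (0 + of_int (int n) * (2 * pi)) = f 0 + of_int (int n) * a"
    by (rule shift_of_int) (rule shift)
  then have "f (real n * (2 * pi)) = f 0 + real n * a" by simp
  moreover have "\<bar>f (real n * (2 * pi)) - real n\<bar> \<le> B" "\<bar>f 0\<bar> \<le> B"
    using near[of "real n * (2 * pi)"] near[of 0] by simp_all
  ultimately have "\<bar>real n * a - real n\<bar> \<le> 2 * B" by linarith
  moreover have "\<bar>real n * a - real n\<bar> = real n * \<bar>a - 1\<bar>"
    using abs_mult[of "real n" "a - 1"] by (simp add: right_diff_distrib)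
  ultimately show False using n by simp
qed

lemma initial_condition_bounds:
  assumes F: "viscosity_solution F" and init: "has_initial_condition F F0"
  shows "\<forall>\<^sub>F y in nhds x. F0 y \<le> b \<Longrightarrow> F (0, x) \<le> b"
    and "\<forall>\<^sub>F y in nhds x. b \<le> F0 y \<Longrightarrow> b \<le> lower_envelope half_space F (0, x)"
proof -
  have nhds: "nhds_within x UNIV = nhds x" for x :: real by (simp add: nhds_within_def)
  have "locally_bounded_on half_space F" using F by (simp add: viscosity_solution_def)
  then have "F (0, x) \<le> upper_envelope half_space F (0, x)"
    by (rule le_upper_envelope) (simp add: half_space_def)
  also have "\<dots> \<le> upper_envelope UNIV F0 x" using init by (simp add: has_initial_condition_def)
  finally show "F (0, x) \<le> b" if "\<forall>\<^sub>F y in nhds x. F0 y \<le> b"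
    using upper_envelope_le[of F0 b x UNIV] that by (simp add: nhds)
  have "lower_envelope UNIV F0 x \<le> lower_envelope half_space F (0, x)"
    using init by (simp add: has_initial_condition_def)
  then show "b \<le> lower_envelope half_space F (0, x)" if "\<forall>\<^sub>F y in nhds x. b \<le> F0 y"
    using le_lower_envelope[of b F0 x UNIV] that by (simp add: nhds)
qed

text \<open>Membership in \<open>F_space\<close> gives one unknown jump for all times. At time 0 the
  initial condition keeps the solution and its envelope within a bounded distance of
  \<open>x / (2 * pi)\<close>, which forces the jump to be 1.\<close>

lemma viscosity_solution_shift:
  assumes F: "viscosity_solution F" and init: "has_initial_condition F (circle_cdf \<mu>)"
    and \<mu>: "circle_prob \<mu>" and "t \<ge> 0"
  shows "F (t, x + 2 * pi) = F (t, x) + 1"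
    and "lower_envelope half_space F (t, x + 2 * pi) = lower_envelope half_space F (t, x) + 1"
proof -
  define L where "L = lower_envelope half_space F"
  have near: "\<forall>\<^sub>F y in nhds x. circle_cdf \<mu> y \<le> x / (2 * pi) + 2"
    "\<forall>\<^sub>F y in nhds x. x / (2 * pi) - 2 \<le> circle_cdf \<mu> y" for x :: real
  proof -
    have "\<forall>\<^sub>F y in nhds x. dist y x < 1"
      unfolding eventually_nhds_metric by (intro exI[of _ 1]) simp
    then have *: "\<forall>\<^sub>F y in nhds x. \<bar>circle_cdf \<mu> y - x / (2 * pi)\<bar> \<le> 2"
    proof eventually_elim
      case (elim y)
      have "y / (2 * pi) - x / (2 * pi) = (y - x) / (2 * pi)" by (simp add: diff_divide_distrib)
      moreover have "\<bar>(y - x) / (2 * pi)\<bar> \<le> 1"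
        using elim pi_gt3 by (simp add: dist_real_def abs_divide divide_le_eq)
      ultimately show ?case using circle_cdf_near_linear[OF \<mu>, of y] by linarith
    qed
    show "\<forall>\<^sub>F y in nhds x. circle_cdf \<mu> y \<le> x / (2 * pi) + 2"
      "\<forall>\<^sub>F y in nhds x. x / (2 * pi) - 2 \<le> circle_cdf \<mu> y"
      using * by (eventually_elim, linarith)+
  qed
  have "L (0, x) \<le> F (0, x)" for x
    unfolding L_def using F
    by (intro lower_envelope_le) (auto simp: viscosity_solution_def half_space_def)
  moreover have "F (0, x) \<le> x / (2 * pi) + 2" "x / (2 * pi) - 2 \<le> L (0, x)" for x
    unfolding L_def
    by (rule initial_condition_bounds(1)[OF F init near(1)] initial_condition_bounds(2)[OF F init near(2)])+
  ultimately have bounds: "\<bar>F (0, x) - x / (2 * pi)\<bar> \<le> 2" "\<bar>L (0, x) - x / (2 * pi)\<bar> \<le> 2" for x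
    by (smt (verit))+
  have "F \<in> F_space" "L \<in> F_space"
    using F by (auto simp: viscosity_solution_def viscosity_subsolution_def
        viscosity_supersolution_def L_def)
  then obtain a1 a2 where a1: "\<And>t x. t \<ge> 0 \<Longrightarrow> F (t, x + 2 * pi) = F (t, x) + a1"
    and a2: "\<And>t x. t \<ge> 0 \<Longrightarrow> L (t, x + 2 * pi) = L (t, x) + a2"
    unfolding F_space_def by blast
  have "a1 = 1" by (rule quasi_periodic_jump_unique[of "\<lambda>x. F (0, x)"]) (use a1 bounds in auto)
  moreover have "a2 = 1" by (rule quasi_periodic_jump_unique[of "\<lambda>x. L (0, x)"]) (use a2 bounds in auto)
  ultimately show "F (t, x + 2 * pi) = F (t, x) + 1"
    "lower_envelope half_space F (t, x + 2 * pi) = lower_envelope half_space F (t, x) + 1"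
    using a1[OF \<open>t \<ge> 0\<close>] a2[OF \<open>t \<ge> 0\<close>] by (simp_all add: L_def)
qed

text \<open>The supersolution in the comparison is the lower envelope of \<open>G\<close>, which
  lies below \<open>G\<close>. The initial data are compared through bounds valid near each point,
  because initial conditions hold only between envelopes and a distribution function may
  jump.\<close>

lemma viscosity_solution_comparison:
  assumes F: "viscosity_solution F" "has_initial_condition F (circle_cdf \<mu>)" "circle_prob \<mu>"
      "\<exists>m>0. space_growth m F"
    and G: "viscosity_solution G" "has_initial_condition G (circle_cdf \<nu>)" "circle_prob \<nu>"
    and near: "\<And>x. \<exists>c. (\<forall>\<^sub>F y in nhds x. circle_cdf \<mu> y \<le> c + e) \<and> (\<forall>\<^sub>F y in nhds x. c \<le> circle_cdf \<nu> y)"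
    and "t \<ge> 0"
  shows "F (t, x) \<le> G (t, x) + e"
proof -
  obtain m where m: "m > 0" "space_growth m F" using F(4) by blast
  have init: "F (0, y) \<le> lower_envelope half_space G (0, y) + e" for y
  proof -
    obtain c where c: "\<forall>\<^sub>F z in nhds y. circle_cdf \<mu> z \<le> c + e" "\<forall>\<^sub>F z in nhds y. c \<le> circle_cdf \<nu> z"
      using near by blast
    show ?thesis
      using initial_condition_bounds(1)[OF F(1,2) c(1)] initial_condition_bounds(2)[OF G(1,2) c(2)]
      by linarith
  qed
  have "viscosity_subsolution F" "viscosity_supersolution (lower_envelope half_space G)"
    using F(1) G(1) by (simp_all add: viscosity_solution_def)
  from comparison_principle[OF this m(2,1) viscosity_solution_shift(1)[OF F(1-3)]
      viscosity_solution_shift(2)[OF G] init \<open>t \<ge> 0\<close>]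
  have "F (t, x) \<le> lower_envelope half_space G (t, x) + e" .
  also have "lower_envelope half_space G (t, x) \<le> G (t, x)"
    using G(1) \<open>t \<ge> 0\<close> by (intro lower_envelope_le) (auto simp: viscosity_solution_def half_space_def)
  finally show ?thesis by simp
qed

section \<open>Essential supremum and conclusion\<close>

lemma Linf_norm_nonneg: "0 \<le> Linf_norm f"
proof -
  have "esssup lborel (\<lambda>x::real. 0 :: ereal) \<le> Linf_norm f"
    unfolding Linf_norm_def by (rule esssup_mono) auto
  then show ?thesis by (simp add: esssup_const)
qed

lemma Linf_norm_le:
  assumes "f \<in> borel_measurable borel" "\<And>x. \<bar>f x\<bar> \<le> b"
  shows "Linf_norm f \<le> ereal b"
  unfolding Linf_norm_def using assms by (intro esssup_I) auto

lemma space_growth_imp_measurable: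
  assumes "space_growth m F" "m > 0" "t \<ge> 0"
  shows "(\<lambda>x. F (t, x)) \<in> borel_measurable borel"
proof (rule borel_measurable_mono, rule monoI)
  fix x y :: real assume "x \<le> y"
  then have "m * (y - x) \<le> F (t, x + (y - x)) - F (t, x)"
    using assms unfolding space_growth_def by (metis diff_ge_0_iff_ge)
  moreover have "0 \<le> m * (y - x)" using \<open>m > 0\<close> \<open>x \<le> y\<close> by simp
  ultimately show "F (t, x) \<le> F (t, y)" by simp
qed

theorem theorem1p3:
  fixes m :: real
    and \<mu> :: "nat \<Rightarrow> real measure" and \<mu>inf :: "real measure"
    and F :: "nat \<Rightarrow> real \<times> real \<Rightarrow> real" and Finf :: "real \<times> real \<Rightarrow> real"
  assumes "m > 0"
    and "\<And>n. circle_prob (\<mu> n)"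
    and "\<And>n \<theta> h. h \<ge> 0 \<Longrightarrow> circle_cdf (\<mu> n) (\<theta> + h) - circle_cdf (\<mu> n) \<theta> \<ge> m * h"
    and "circle_prob \<mu>inf"
    and "circle_conv_in_law \<mu> \<mu>inf"
    and "absolutely_continuous lborel \<mu>inf"
    and "\<And>n. viscosity_solution (F n)"
    and "\<And>n. has_initial_condition (F n) (circle_cdf (\<mu> n))"
    and "viscosity_solution Finf"
    and "has_initial_condition Finf (circle_cdf \<mu>inf)"
    and "\<And>n. \<exists>m'. 0 < m' \<and> m' \<le> m \<and> space_growth m' (F n)"
    and "\<exists>m'. 0 < m' \<and> m' \<le> m \<and> space_growth m' Finf"
  shows "(\<lambda>n. SUP t\<in>{0..}. Linf_norm (\<lambda>\<theta>. F n (t, \<theta>) - Finf (t, \<theta>))) \<longlonglongrightarrow> 0"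
proof -
  define c where "c = circle_cdf \<mu>inf"
  have grow: "\<exists>m'>0. space_growth m' (F n)" "\<exists>m'>0. space_growth m' Finf" for n
    using assms(11)[of n] assms(12) by blast+
  have cont: "isCont c x" for x unfolding c_def by (rule isCont_circle_cdf[OF assms(4,6)])
  have mono: "mono (circle_cdf (\<mu> n))" for n
  proof (rule monoI)
    fix x y :: real assume "x \<le> y"
    then have "m * (y - x) \<le> circle_cdf (\<mu> n) (x + (y - x)) - circle_cdf (\<mu> n) x"
      by (intro assms(3)) simp
    moreover have "0 \<le> m * (y - x)" using \<open>m > 0\<close> \<open>x \<le> y\<close> by simp
    ultimately show "circle_cdf (\<mu> n) x \<le> circle_cdf (\<mu> n) y" by simp
  qed
  \<comment> \<open>One \<open>e\<close> is the uniform distance of the distribution functions. The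
    other two are the oscillation of \<open>c\<close> near \<open>x\<close>, counted once in each of
    the two local bounds that the comparison requires.\<close>
  have small: "\<forall>\<^sub>F n in sequentially.
      (SUP t\<in>{0..}. Linf_norm (\<lambda>\<theta>. F n (t, \<theta>) - Finf (t, \<theta>))) \<le> ereal (3 * e)" if "e > 0" for e
  proof -
    have "\<forall>\<^sub>F n in sequentially. \<forall>x. \<bar>circle_cdf (\<mu> n) x - c x\<bar> \<le> e"
      unfolding c_def
    proof (rule mono_tendsto_continuous_imp_uniform[OF mono])
      show "(\<lambda>n. circle_cdf (\<mu> n) x) \<longlonglongrightarrow> circle_cdf \<mu>inf x" for x
        by (rule circle_conv_in_law_imp_cdf_tendsto[OF assms(2,4,5,6)])
      show "continuous_on UNIV (circle_cdf \<mu>inf)"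
        using cont by (simp add: continuous_at_imp_continuous_on c_def)
      show "circle_cdf (\<mu> n) (x + 2 * pi) = circle_cdf (\<mu> n) x + 1"
        "circle_cdf \<mu>inf (x + 2 * pi) = circle_cdf \<mu>inf x + 1" for n x
        by (rule circle_cdf_shift, fact)+
    qed (use that in auto)
    then show ?thesis
    proof eventually_elim
      case (elim n)
      have near: "\<forall>\<^sub>F y in nhds x. \<bar>c y - c x\<bar> < e" for x
        using tendstoD[OF cont[of x, unfolded continuous_at tendsto_at_iff_tendsto_nhds] that]
        by (simp add: dist_real_def)
      have le: "F n (t, x) \<le> Finf (t, x) + 3 * e" if "t \<ge> 0" for t x
      proof (rule viscosity_solution_comparison[OF assms(7,8,2) grow(1) assms(9,10,4) _ that])
        fix x
        have "\<forall>\<^sub>F y in nhds x. circle_cdf (\<mu> n) y \<le> (c x - e) + 3 * e"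
          using near[of x]
        proof eventually_elim
          case (elim y)
          then show ?case using \<open>\<forall>x. \<bar>circle_cdf (\<mu> n) x - c x\<bar> \<le> e\<close>[rule_format, of y] by linarith
        qed
        moreover have "\<forall>\<^sub>F y in nhds x. c x - e \<le> circle_cdf \<mu>inf y"
          using near[of x] unfolding c_def by eventually_elim linarith
        ultimately show "\<exists>c. (\<forall>\<^sub>F y in nhds x. circle_cdf (\<mu> n) y \<le> c + 3 * e) \<and>
            (\<forall>\<^sub>F y in nhds x. c \<le> circle_cdf \<mu>inf y)" by blast
      qed
      have ge: "Finf (t, x) \<le> F n (t, x) + 3 * e" if "t \<ge> 0" for t x
      proof (rule viscosity_solution_comparison[OF assms(9,10,4) grow(2) assms(7,8,2) _ that])
        fix x
        have "\<forall>\<^sub>F y in nhds x. c x - 2 * e \<le> circle_cdf (\<mu> n) y"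
          using near[of x]
        proof eventually_elim
          case (elim y)
          then show ?case using \<open>\<forall>x. \<bar>circle_cdf (\<mu> n) x - c x\<bar> \<le> e\<close>[rule_format, of y] by linarith
        qed
        moreover have "\<forall>\<^sub>F y in nhds x. circle_cdf \<mu>inf y \<le> (c x - 2 * e) + 3 * e"
          using near[of x] unfolding c_def by eventually_elim linarith
        ultimately show "\<exists>c. (\<forall>\<^sub>F y in nhds x. circle_cdf \<mu>inf y \<le> c + 3 * e) \<and>
            (\<forall>\<^sub>F y in nhds x. c \<le> circle_cdf (\<mu> n) y)" by blast
      qed
      show ?case
      proof (rule SUP_least)
        fix t :: real assume "t \<in> {0..}"
        then have "t \<ge> 0" by simp
        obtain m1 m2 where "m1 > 0" "space_growth m1 (F n)" "m2 > 0" "space_growth m2 Finf"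
          using grow by blast
        then have "(\<lambda>\<theta>. F n (t, \<theta>) - Finf (t, \<theta>)) \<in> borel_measurable borel"
          using \<open>t \<ge> 0\<close> by (intro borel_measurable_diff space_growth_imp_measurable)
        moreover have "\<bar>F n (t, \<theta>) - Finf (t, \<theta>)\<bar> \<le> 3 * e" for \<theta>
          using le[OF \<open>t \<ge> 0\<close>, of \<theta>] ge[OF \<open>t \<ge> 0\<close>, of \<theta>] by linarith
        ultimately show "Linf_norm (\<lambda>\<theta>. F n (t, \<theta>) - Finf (t, \<theta>)) \<le> ereal (3 * e)"
          by (rule Linf_norm_le)
      qed
    qed
  qed
  show ?thesis
  proof (rule order_tendstoI)
    fix a :: ereal assume "a < 0"
    have "0 \<le> (SUP t\<in>{0..}. Linf_norm (\<lambda>\<theta>. F n (t, \<theta>) - Finf (t, \<theta>)))" for n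
      by (rule SUP_upper2[of 0]) (auto intro: Linf_norm_nonneg)
    with \<open>a < 0\<close> show "\<forall>\<^sub>F n in sequentially. a < (SUP t\<in>{0..}. Linf_norm (\<lambda>\<theta>. F n (t, \<theta>) - Finf (t, \<theta>)))"
      by (intro always_eventually allI) (rule less_le_trans)
  next
    fix a :: ereal assume "0 < a"
    then obtain r where r: "0 < ereal r" "ereal r < a" using ereal_dense2 by blast
    have "\<forall>\<^sub>F n in sequentially.
      (SUP t\<in>{0..}. Linf_norm (\<lambda>\<theta>. F n (t, \<theta>) - Finf (t, \<theta>))) \<le> ereal (3 * (r / 3))"
      using r(1) by (intro small) simp
    then show "\<forall>\<^sub>F n in sequentially. (SUP t\<in>{0..}. Linf_norm (\<lambda>\<theta>. F n (t, \<theta>) - Finf (t, \<theta>))) < a"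
      by eventually_elim (use r(2) in auto)
  qed
qed

end
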